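(* Let $\mathcal{H}$ be a complex Hilbert space of finite or countably infinite dimension, and let $\mathsf{B}=\{\mathsf{B}_y\}_{y\in\Omega_{\mathsf{B}}}$ be an observable on $\mathcal{H}$ such that $$\mathsf{B}_y^2\in\overline{\mathrm{span}}\,\mathsf{B}\qquad\text{for all } y\in\Omega_{\mathsf{B}},$$ where $\overline{\mathrm{span}}\,\mathsf{B}$ denotes the closure, in the $\sigma$-weak operator topology, of the set of all finite complex linear combinations of the operators $\mathsf{B}_y$, $y\in\Omega_{\mathsf{B}}$. Then for every observable $\mathsf{A}$ on $\mathcal{H}$: $\mathsf{A}$ can be measured without disturbing $\mathsf{B}$ if and only if $\mathsf{A}$ and $\mathsf{B}$ commute.
   Context: An observable on $\mathcal{H}$ is a finite or countably infinite family $\mathsf{A}=\{\mathsf{A}_x\}_{x\in\Omega_{\mathsf{A}}}$ of positive bounded operators on $\mathcal{H}$ with $\sum_x\mathsf{A}_x=\mathbb{1}$ (a discrete POVM). Observables $\mathsf{A},\mathsf{B}$ commute if $\mathsf{A}_x\mathsf{B}_y=\mathsf{B}_y\mathsf{A}_x$ for all $x\in\Omega_{\mathsf{A}},y\in\Omega_{\mathsf{B}}$. An instrument implementing $\mathsf{A}$ is a family $\mathcal{I}=\{\mathcal{I}_x\}_{x\in\Omega_{\mathsf{A}}}$ of completely positive linear maps on the trace class operators on $\mathcal{H}$ such that $\mathcal{I}_x^*(\mathbb{1})=\mathsf{A}_x$ for all $x$; here the adjoint $\mathcal{I}_x^*$, acting on bounded operators, is defined by $\mathrm{tr}[X\,\mathcal{I}_x(Y)]=\mathrm{tr}[\mathcal{I}_x^*(X)Y]$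 for all bounded $X$ and trace class $Y$. Put $\mathcal{I}_\Omega:=\sum_x\mathcal{I}_x$ (a quantum channel), with adjoint $\mathcal{I}_\Omega^*$. $\mathsf{A}$ can be measured without disturbing $\mathsf{B}$ if there is an instrument $\mathcal{I}$ implementing $\mathsf{A}$ with $\mathcal{I}_\Omega^*(\mathsf{B}_y)=\mathsf{B}_y$ for all $y\in\Omega_{\mathsf{B}}$. *)

theory Defs
  imports "HOL-Analysis.Analysis"
begin

section \<open>Complex Hilbert spaces\<close>

text \<open>
  The norm axiom makes the inner product positive definite, since the square root is negative on
  negative reals.  Completeness comes from the superclass.  The inner product is conjugate linear
  in its first argument.
\<close>

class complex_hilbert = banach +
  fixes scaleC :: "complex \<Rightarrow> 'a \<Rightarrow> 'a"  (infixr "*\<^sub>C" 75)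
    and cinner :: "'a \<Rightarrow> 'a \<Rightarrow> complex"  (infix "\<bullet>\<^sub>C" 70)
  assumes scaleC_add_right: "c *\<^sub>C (x + y) = c *\<^sub>C x + c *\<^sub>C y"
    and scaleC_add_left: "(c + d) *\<^sub>C x = c *\<^sub>C x + d *\<^sub>C x"
    and scaleC_scaleC: "c *\<^sub>C d *\<^sub>C x = (c * d) *\<^sub>C x"
    and scaleR_eq_scaleC: "r *\<^sub>R x = complex_of_real r *\<^sub>C x"
    and cinner_commute: "x \<bullet>\<^sub>C y = cnj (y \<bullet>\<^sub>C x)"
    and cinner_add_right: "x \<bullet>\<^sub>C (y + z) = x \<bullet>\<^sub>C y + x \<bullet>\<^sub>C z"
    and cinner_scaleC_right: "x \<bullet>\<^sub>C (c *\<^sub>C y) = c * (x \<bullet>\<^sub>C y)"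
    and norm_eq_sqrt_cinner: "norm x = sqrt (Re (x \<bullet>\<^sub>C x))"

definition is_onb :: "'a::complex_hilbert set \<Rightarrow> bool" where
  "is_onb E \<longleftrightarrow>
     (\<forall>e\<in>E. norm e = 1) \<and> (\<forall>e\<in>E. \<forall>f\<in>E. e \<noteq> f \<longrightarrow> e \<bullet>\<^sub>C f = 0) \<and>
     (\<forall>x. (\<forall>e\<in>E. e \<bullet>\<^sub>C x = 0) \<longrightarrow> x = 0)"

section \<open>Bounded and trace class operators\<close>

definition bounded_clinear :: "('a::complex_hilbert \<Rightarrow> 'a) \<Rightarrow> bool" where
  "bounded_clinear T \<longleftrightarrow> bounded_linear T \<and> (\<forall>c x. T (c *\<^sub>C x) = c *\<^sub>C T x)"

definition positive_op :: "('a::complex_hilbert \<Rightarrow> 'a) \<Rightarrow> bool" where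
  "positive_op T \<longleftrightarrow> bounded_clinear T \<and> (\<forall>x. x \<bullet>\<^sub>C T x \<in> \<real>\<^sub>\<ge>\<^sub>0)"

text \<open>
  \<open>is_abs_op T P\<close> says that \<open>P\<close> is the positive square root of \<open>T\<^sup>* T\<close>, that is, \<open>P = |T|\<close>.
\<close>

definition is_abs_op :: "('a::complex_hilbert \<Rightarrow> 'a) \<Rightarrow> ('a \<Rightarrow> 'a) \<Rightarrow> bool" where
  "is_abs_op T P \<longleftrightarrow> positive_op P \<and> (\<forall>x y. x \<bullet>\<^sub>C P (P y) = T x \<bullet>\<^sub>C T y)"

definition trace_class :: "('a::complex_hilbert \<Rightarrow> 'a) \<Rightarrow> bool" where
  "trace_class T \<longleftrightarrow> bounded_clinear T \<and>
     (\<exists>P E. is_abs_op T P \<and> is_onb E \<and> (\<lambda>e. e \<bullet>\<^sub>C P e) summable_on E)"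

text \<open>The trace of a trace class operator does not depend on the chosen orthonormal basis.\<close>

definition trace_op :: "('a::complex_hilbert \<Rightarrow> 'a) \<Rightarrow> complex" where
  "trace_op T = (\<Sum>\<^sub>\<infinity>e\<in>(SOME E. is_onb E). e \<bullet>\<^sub>C T e)"

text \<open>
  The \<open>\<sigma>\<close>-weak operator topology on the bounded operators: the weakest topology that makes
  \<open>X \<mapsto> tr[X T]\<close> continuous for every trace class operator \<open>T\<close>.
\<close>

definition sigma_weak_topology :: "('a::complex_hilbert \<Rightarrow> 'a) topology" where
  "sigma_weak_topology = topology_generated_by
     {{X. bounded_clinear X \<and> trace_op (X \<circ> T) \<in> U} | T U. trace_class T \<and> open U}"

definition op_span :: "'i set \<Rightarrow> ('i \<Rightarrow> 'a::complex_hilbert \<Rightarrow> 'a) \<Rightarrow> ('a \<Rightarrow> 'a) set" where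
  "op_span \<Omega> B = {(\<lambda>\<psi>. \<Sum>y\<in>F. c y *\<^sub>C B y \<psi>) | F c. finite F \<and> F \<subseteq> \<Omega>}"

section \<open>Observables and instruments\<close>

text \<open>
  The sum over outcomes is taken in the strong operator topology; for positive operators with
  bounded partial sums this agrees with weak and \<open>\<sigma>\<close>-weak convergence.
\<close>

definition observable :: "'i set \<Rightarrow> ('i \<Rightarrow> 'a::complex_hilbert \<Rightarrow> 'a) \<Rightarrow> bool" where
  "observable \<Omega> A \<longleftrightarrow> countable \<Omega> \<and> (\<forall>x\<in>\<Omega>. positive_op (A x)) \<and>
     (\<forall>\<psi>. ((\<lambda>x. A x \<psi>) has_sum \<psi>) \<Omega>)"

definition observables_commute ::
  "'i set \<Rightarrow> ('i \<Rightarrow> 'a::complex_hilbert \<Rightarrow> 'a) \<Rightarrow> 'j set \<Rightarrow> ('j \<Rightarrow> 'a \<Rightarrow> 'a) \<Rightarrow> bool" where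
  "observables_commute \<Omega>\<^sub>A A \<Omega>\<^sub>B B \<longleftrightarrow> (\<forall>x\<in>\<Omega>\<^sub>A. \<forall>y\<in>\<Omega>\<^sub>B. A x \<circ> B y = B y \<circ> A x)"

definition trace_class_linear ::
  "(('a::complex_hilbert \<Rightarrow> 'a) \<Rightarrow> ('a \<Rightarrow> 'a)) \<Rightarrow> bool" where
  "trace_class_linear \<Phi> \<longleftrightarrow>
     (\<forall>T. trace_class T \<longrightarrow> trace_class (\<Phi> T)) \<and>
     (\<forall>S T. trace_class S \<longrightarrow> trace_class T \<longrightarrow> \<Phi> (\<lambda>\<psi>. S \<psi> + T \<psi>) = (\<lambda>\<psi>. \<Phi> S \<psi> + \<Phi> T \<psi>)) \<and>
     (\<forall>c T. trace_class T \<longrightarrow> \<Phi> (\<lambda>\<psi>. c *\<^sub>C T \<psi>) = (\<lambda>\<psi>. c *\<^sub>C \<Phi> T \<psi>))"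

text \<open>
  Positivity of the operator matrix with entries \<open>T i j\<close>, \<open>i, j < n\<close>, acting on the \<open>n\<close>-fold
  direct sum of the Hilbert space.  Complete positivity is positivity of all amplifications, which
  act on such matrices entrywise.
\<close>

definition positive_block :: "nat \<Rightarrow> (nat \<Rightarrow> nat \<Rightarrow> 'a::complex_hilbert \<Rightarrow> 'a) \<Rightarrow> bool" where
  "positive_block n T \<longleftrightarrow> (\<forall>\<psi>. (\<Sum>i<n. \<Sum>j<n. \<psi> i \<bullet>\<^sub>C T i j (\<psi> j)) \<in> \<real>\<^sub>\<ge>\<^sub>0)"

definition completely_positive ::
  "(('a::complex_hilbert \<Rightarrow> 'a) \<Rightarrow> ('a \<Rightarrow> 'a)) \<Rightarrow> bool" where
  "completely_positive \<Phi> \<longleftrightarrow>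
     (\<forall>n T. (\<forall>i<n. \<forall>j<n. trace_class (T i j)) \<longrightarrow> positive_block n T \<longrightarrow>
        positive_block n (\<lambda>i j. \<Phi> (T i j)))"

text \<open>
  \<open>dual_value \<Phi> X Z\<close> says \<open>\<Phi>\<^sup>*(X) = Z\<close> for the adjoint \<open>\<Phi>\<^sup>*\<close>, which acts on bounded operators;
  \<open>Z\<close> is uniquely determined by \<open>\<Phi>\<close> and \<open>X\<close>.
\<close>

definition dual_value ::
  "(('a::complex_hilbert \<Rightarrow> 'a) \<Rightarrow> ('a \<Rightarrow> 'a)) \<Rightarrow> ('a \<Rightarrow> 'a) \<Rightarrow> ('a \<Rightarrow> 'a) \<Rightarrow> bool" where
  "dual_value \<Phi> X Z \<longleftrightarrow> bounded_clinear X \<and> bounded_clinear Z \<and>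
     (\<forall>Y. trace_class Y \<longrightarrow> trace_op (X \<circ> \<Phi> Y) = trace_op (Z \<circ> Y))"

definition implements ::
  "'i set \<Rightarrow> ('i \<Rightarrow> ('a::complex_hilbert \<Rightarrow> 'a) \<Rightarrow> ('a \<Rightarrow> 'a)) \<Rightarrow> ('i \<Rightarrow> 'a \<Rightarrow> 'a) \<Rightarrow> bool" where
  "implements \<Omega> I A \<longleftrightarrow>
     (\<forall>x\<in>\<Omega>. trace_class_linear (I x) \<and> completely_positive (I x) \<and> dual_value (I x) id (A x))"

text \<open>
  For an instrument implementing an observable the sum over outcomes converges in trace norm, hence
  also pointwise in norm; the limit is written here in the latter sense.
\<close>

definition total_channel ::
  "'i set \<Rightarrow> ('i \<Rightarrow> ('a::complex_hilbert \<Rightarrow> 'a) \<Rightarrow> ('a \<Rightarrow> 'a)) \<Rightarrow> ('a \<Rightarrow> 'a) \<Rightarrow> ('a \<Rightarrow> 'a)" where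
  "total_channel \<Omega> I Y = (\<lambda>\<psi>. \<Sum>\<^sub>\<infinity>x\<in>\<Omega>. I x Y \<psi>)"

definition measurable_without_disturbing ::
  "'i set \<Rightarrow> ('i \<Rightarrow> 'a::complex_hilbert \<Rightarrow> 'a) \<Rightarrow> 'j set \<Rightarrow> ('j \<Rightarrow> 'a \<Rightarrow> 'a) \<Rightarrow> bool" where
  "measurable_without_disturbing \<Omega>\<^sub>A A \<Omega>\<^sub>B B \<longleftrightarrow>
     (\<exists>I. implements \<Omega>\<^sub>A I A \<and> (\<forall>y\<in>\<Omega>\<^sub>B. dual_value (total_channel \<Omega>\<^sub>A I) (B y) (B y)))"

end

theory Submission
  imports Defs
begin

text \<open>
  If \<open>A\<close> and \<open>B\<close> commute, the Lueders instrument \<open>Y \<mapsto> A\<^sub>x\<^sup>1\<^sup>/\<^sup>2 Y A\<^sub>x\<^sup>1\<^sup>/\<^sup>2\<close> does not disturb \<open>B\<close>.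

  Conversely, let \<open>\<Phi>\<close> be the total channel of a nondisturbing instrument \<open>I\<close>.  Its adjoint fixes
  every \<open>B\<^sub>y\<close>, hence by \<open>\<sigma>\<close>-weak continuity also \<open>B\<^sub>y\<^sup>2\<close>.  For vectors \<open>\<psi>\<close> and \<open>\<eta>\<close> put
  \<open>q\<^sub>x(\<eta>) = \<langle>\<psi>, I\<^sub>x\<^sup>*(B\<^sub>y\<^sup>2) \<psi>\<rangle> + 2 Re \<langle>\<eta>, I\<^sub>x\<^sup>*(B\<^sub>y) \<psi>\<rangle> + \<langle>\<eta>, A\<^sub>x \<eta>\<rangle>\<close>.  Complete positivity (for
  \<open>2 \<times> 2\<close> blocks) gives \<open>q\<^sub>x \<ge> 0\<close>, and the sum of \<open>q\<^sub>x(-B\<^sub>y \<psi>)\<close> over all \<open>x\<close> is \<open>0\<close>.  So each \<open>q\<^sub>x\<close> has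
  a minimum at \<open>-B\<^sub>y \<psi>\<close>, and its vanishing derivative says \<open>I\<^sub>x\<^sup>*(B\<^sub>y) = A\<^sub>x B\<^sub>y\<close>.  As the left-hand side
  is selfadjoint, \<open>A\<^sub>x\<close> and \<open>B\<^sub>y\<close> commute.
\<close>

section \<open>Inner products\<close>

text \<open>Infinite sums shape the proof. Outcome sums converge only pointwise on vectors, and
  \<open>trace_op\<close> is a sum over one chosen basis, so most trace identities exchange sums
  over outcomes and over basis vectors. Joint summability comes from |<u, v>| \<le> (|u|^2 + |v|^2)
  / 2, which asks that trace class operators be split into Hilbert-Schmidt factors; square roots and
  the polar decomposition supply the splitting.

  The total of q_x(-B_y psi) is <psi, B_y^2 psi> - 2 |B_y psi|^2 + |B_y psi|^2. The first term is
  where the closure hypothesis enters: for a general channel whose adjoint fixes B_y, only the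
  Kadison-Schwarz inequality holds at B_y^2, and a positive remainder could survive.

  The adjoint of I_x is never formed at B_y or B_y^2; its quadratic form is read off from traces of
  I_x(|psi><psi|). In the other direction the square root of A_x must commute with B_y, so the
  existence statement for square roots carries the commutant along.\<close>

lemma cinner_self: "(x::'a::complex_hilbert) \<bullet>\<^sub>C x = complex_of_real ((norm x)\<^sup>2)"
proof -
  have "Im (x \<bullet>\<^sub>C x) = 0"
    using cinner_commute[of x x] by (metis complex_cnj_cancel_iff Reals_cnj_iff complex_is_Real_iff)
  moreover have "Re (x \<bullet>\<^sub>C x) \<ge> 0"
    using norm_ge_zero[of x] unfolding norm_eq_sqrt_cinner[of x] by simp
  ultimately show ?thesis
    unfolding norm_eq_sqrt_cinner[of x] by (simp add: complex_eq_iff)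
qed

text \<open>The class already supplies the triangle inequality, so Cauchy-Schwarz is read off
  backwards from it, by expanding |x + y|^2.\<close>

lemma Re_cinner_le: "Re (x \<bullet>\<^sub>C y) \<le> norm x * norm (y::'a::complex_hilbert)"
proof -
  have "x \<bullet>\<^sub>C y + y \<bullet>\<^sub>C x = complex_of_real (2 * Re (x \<bullet>\<^sub>C y))"
    using cinner_commute[of y x] by (simp add: complex_add_cnj)
  moreover have "(x + y) \<bullet>\<^sub>C (x + y) = x \<bullet>\<^sub>C x + (x \<bullet>\<^sub>C y + y \<bullet>\<^sub>C x) + y \<bullet>\<^sub>C y"
    using cinner_commute[of "x + y" x] cinner_commute[of "x + y" y]
      cinner_commute[of x x] cinner_commute[of y x] cinner_commute[of y y]
    by (simp add: cinner_add_right)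
  ultimately have "(norm (x + y))\<^sup>2 = (norm x)\<^sup>2 + 2 * Re (x \<bullet>\<^sub>C y) + (norm y)\<^sup>2"
    unfolding cinner_self by (simp add: complex_eq_iff)
  moreover have "(norm (x + y))\<^sup>2 \<le> (norm x + norm y)\<^sup>2"
    by (intro power_mono norm_triangle_ineq) simp
  ultimately show ?thesis by (simp add: power2_sum)
qed

lemma norm_scaleC: "norm (c *\<^sub>C (x::'a::complex_hilbert)) = cmod c * norm x"
proof -
  have "(c *\<^sub>C x) \<bullet>\<^sub>C (c *\<^sub>C x) = c * cnj c * (x \<bullet>\<^sub>C x)"
    using cinner_commute[of "c *\<^sub>C x" x] cinner_commute[of x x] by (simp add: cinner_scaleC_right)
  also have "\<dots> = complex_of_real ((cmod c * norm x)\<^sup>2)"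
    unfolding cinner_self by (simp add: complex_norm_square[symmetric] power_mult_distrib)
  finally have "(norm (c *\<^sub>C x))\<^sup>2 = (cmod c * norm x)\<^sup>2"
    unfolding cinner_self of_real_eq_iff .
  then show ?thesis by simp
qed

lemma norm_cinner_le: "cmod (x \<bullet>\<^sub>C y) \<le> norm x * norm (y::'a::complex_hilbert)"
proof (cases "x \<bullet>\<^sub>C y = 0")
  case False
  \<comment> \<open>A phase that rotates the inner product onto its modulus, reducing the claim to
    the bound on real parts.\<close>
  define c where "c = cnj (sgn (x \<bullet>\<^sub>C y))"
  have "x \<bullet>\<^sub>C (c *\<^sub>C y) = complex_of_real (cmod (x \<bullet>\<^sub>C y))"
    unfolding cinner_scaleC_right c_def using False
    by (simp add: sgn_eq complex_norm_square[symmetric] mult.commute power2_eq_square)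
  then have "cmod (x \<bullet>\<^sub>C y) = Re (x \<bullet>\<^sub>C (c *\<^sub>C y))" by simp
  also have "\<dots> \<le> norm x * norm (c *\<^sub>C y)" by (rule Re_cinner_le)
  also have "norm (c *\<^sub>C y) = norm y" unfolding norm_scaleC using False by (simp add: c_def norm_sgn)
  finally show ?thesis .
qed simp

lemma cinner_scaleC_left: "(c *\<^sub>C x) \<bullet>\<^sub>C y = cnj c * (x \<bullet>\<^sub>C (y::'a::complex_hilbert))"
  using cinner_commute[of "c *\<^sub>C x" y] cinner_commute[of x y] by (simp add: cinner_scaleC_right)

lemma bounded_bilinear_cinner: "bounded_bilinear ((\<bullet>\<^sub>C) :: 'a::complex_hilbert \<Rightarrow> 'a \<Rightarrow> complex)"
proof
  fix x y z :: 'a and r :: real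
  show "(x + y) \<bullet>\<^sub>C z = x \<bullet>\<^sub>C z + y \<bullet>\<^sub>C z"
    using cinner_commute[of "x + y" z] cinner_commute[of x z] cinner_commute[of y z]
    by (simp add: cinner_add_right)
  show "z \<bullet>\<^sub>C (x + y) = z \<bullet>\<^sub>C x + z \<bullet>\<^sub>C y" by (rule cinner_add_right)
  show "(r *\<^sub>R x) \<bullet>\<^sub>C y = r *\<^sub>R (x \<bullet>\<^sub>C y)"
    unfolding scaleR_eq_scaleC cinner_scaleC_left by (simp add: scaleR_conv_of_real)
  show "x \<bullet>\<^sub>C (r *\<^sub>R y) = r *\<^sub>R (x \<bullet>\<^sub>C y)"
    unfolding scaleR_eq_scaleC cinner_scaleC_right by (simp add: scaleR_conv_of_real)
next
  show "\<exists>K. \<forall>(a::'a) b. cmod (a \<bullet>\<^sub>C b) \<le> norm a * norm b * K"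
    by (intro exI[of _ 1]) (simp add: norm_cinner_le)
qed

interpretation cinner: bounded_bilinear "(\<bullet>\<^sub>C) :: 'a::complex_hilbert \<Rightarrow> 'a \<Rightarrow> complex"
  by (rule bounded_bilinear_cinner)

lemma bounded_bilinear_scaleC:
  "bounded_bilinear ((*\<^sub>C) :: complex \<Rightarrow> 'a::complex_hilbert \<Rightarrow> 'a)"
proof
  fix x y :: 'a and c d :: complex and r :: real
  show "(c + d) *\<^sub>C x = c *\<^sub>C x + d *\<^sub>C x" by (rule scaleC_add_left)
  show "c *\<^sub>C (x + y) = c *\<^sub>C x + c *\<^sub>C y" by (rule scaleC_add_right)
  show "(r *\<^sub>R c) *\<^sub>C x = r *\<^sub>R (c *\<^sub>C x)"
    unfolding scaleR_eq_scaleC scaleC_scaleC by (simp add: scaleR_conv_of_real)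
  show "c *\<^sub>C (r *\<^sub>R x) = r *\<^sub>R (c *\<^sub>C x)"
    unfolding scaleR_eq_scaleC scaleC_scaleC by (simp add: mult.commute)
next
  show "\<exists>K. \<forall>a (b::'a). norm (a *\<^sub>C b) \<le> norm a * norm b * K"
    by (intro exI[of _ 1]) (simp add: norm_scaleC)
qed

interpretation scaleC: bounded_bilinear "(*\<^sub>C) :: complex \<Rightarrow> 'a::complex_hilbert \<Rightarrow> 'a"
  by (rule bounded_bilinear_scaleC)

lemma Re_cinner_commute: "Re (x \<bullet>\<^sub>C y) = Re (y \<bullet>\<^sub>C (x::'a::complex_hilbert))"
  using cinner_commute[of x y] by simp

lemma Re_cinner_self: "Re (x \<bullet>\<^sub>C x) = (norm (x::'a::complex_hilbert))\<^sup>2"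
  by (simp add: cinner_self)

lemma norm_diff_sq:
  "(norm (x - y))\<^sup>2 = (norm x)\<^sup>2 - 2 * Re (x \<bullet>\<^sub>C y) + (norm (y::'a::complex_hilbert))\<^sup>2"
  unfolding Re_cinner_self[symmetric]
  by (simp add: cinner.diff_left cinner.diff_right Re_cinner_commute[of y x])

lemma cinner_eqI: "(\<And>x. x \<bullet>\<^sub>C y = x \<bullet>\<^sub>C z) \<Longrightarrow> y = (z::'a::complex_hilbert)"
  by (metis cinner.diff_right cinner_self eq_iff_diff_eq_0 norm_eq_zero of_real_eq_0_iff
      zero_eq_power2)

text \<open>Used for every domination of a double series: it replaces a product by a sum of two
  families that are summable separately.\<close>

lemma norm_cinner_le_half_squares:
  "cmod (x \<bullet>\<^sub>C y) \<le> ((norm x)\<^sup>2 + (norm (y::'a::complex_hilbert))\<^sup>2) / 2"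
  using norm_cinner_le[of x y] sum_squares_bound[of "norm x" "norm y"] by simp

section \<open>Bounded operators\<close>

lemma bounded_clinear_linear: "bounded_clinear T \<Longrightarrow> bounded_linear T"
  by (simp add: bounded_clinear_def)

lemma bounded_clinear_scaleC: "bounded_clinear T \<Longrightarrow> T (c *\<^sub>C x) = c *\<^sub>C T x"
  by (simp add: bounded_clinear_def)

lemma bounded_clinear_add: "bounded_clinear T \<Longrightarrow> T (x + y) = T x + T y"
  by (simp add: bounded_clinear_linear linear_simps)

lemma bounded_clinear_diff: "bounded_clinear T \<Longrightarrow> T (x - y) = T x - T y"
  by (simp add: bounded_clinear_linear linear_simps)

lemma bounded_clinear_scaleR: "bounded_clinear T \<Longrightarrow> T (r *\<^sub>R x) = r *\<^sub>R T x"
  by (simp add: bounded_clinear_linear linear_simps)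

lemma bounded_clinear_zero: "bounded_clinear T \<Longrightarrow> T 0 = 0"
  by (simp add: bounded_clinear_linear linear_simps)

lemma bounded_clinear_bound:
  assumes "bounded_clinear T"
  obtains K where "K > 0" "\<And>x. norm (T x) \<le> K * norm x"
  using bounded_linear.pos_bounded[OF bounded_clinear_linear[OF assms]]
  by (auto simp: mult.commute)

lemma bounded_clinearI:
  assumes "\<And>x y. T (x + y) = T x + T y" "\<And>c x. T (c *\<^sub>C x) = c *\<^sub>C T x"
    and "\<And>x. norm (T x) \<le> K * norm x"
  shows "bounded_clinear T"
  unfolding bounded_clinear_def
proof (intro conjI bounded_linear_intro allI)
  show "T (r *\<^sub>R x) = r *\<^sub>R T x" for r x unfolding scaleR_eq_scaleC by (rule assms(2))
  show "norm (T x) \<le> norm x * K" for x using assms(3)[of x] by (simp add: mult.commute)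
qed (use assms in auto)

lemma bounded_clinear_comp: "bounded_clinear S \<Longrightarrow> bounded_clinear T \<Longrightarrow> bounded_clinear (S \<circ> T)"
  unfolding bounded_clinear_def by (auto simp: o_def bounded_linear_compose)

lemma bounded_clinear_id: "bounded_clinear id"
  by (simp add: bounded_clinear_def id_def bounded_linear_ident)

lemma bounded_clinear_zero_op: "bounded_clinear (\<lambda>_. 0)"
  by (simp add: bounded_clinear_def scaleC.zero_right bounded_linear_zero)

lemma bounded_clinear_plus:
  "bounded_clinear S \<Longrightarrow> bounded_clinear T \<Longrightarrow> bounded_clinear (\<lambda>x. S x + T x)"
  unfolding bounded_clinear_def by (auto simp: bounded_linear_add scaleC_add_right)

lemma bounded_clinear_minus:
  "bounded_clinear S \<Longrightarrow> bounded_clinear T \<Longrightarrow> bounded_clinear (\<lambda>x. S x - T x)"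
  unfolding bounded_clinear_def by (auto simp: bounded_linear_sub scaleC.diff_right)

lemma bounded_clinear_times:
  "bounded_clinear S \<Longrightarrow> bounded_clinear (\<lambda>x. c *\<^sub>C S x)"
  unfolding bounded_clinear_def
  by (auto simp: scaleC_scaleC mult.commute intro: bounded_linear_compose[OF scaleC.bounded_linear_right])

lemma bounded_clinear_timesR:
  "bounded_clinear S \<Longrightarrow> bounded_clinear (\<lambda>x. r *\<^sub>R S x)"
  unfolding scaleR_eq_scaleC by (rule bounded_clinear_times)

lemma bounded_clinear_sum:
  "(\<And>i. i \<in> F \<Longrightarrow> bounded_clinear (S i)) \<Longrightarrow> bounded_clinear (\<lambda>x. \<Sum>i\<in>F. S i x)"
  by (induction F rule: infinite_finite_induct)
     (auto intro: bounded_clinear_zero_op bounded_clinear_plus)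

lemma bounded_clinear_lim:
  assumes T: "\<And>n. bounded_clinear (T n)" and lim: "\<And>x. (\<lambda>n. T n x) \<longlonglongrightarrow> L x"
    and bd: "\<And>n x. norm (T n x) \<le> K * norm x"
  shows "bounded_clinear L" "norm (L x) \<le> K * norm x"
proof -
  have le: "norm (L x) \<le> K * norm x" for x
    by (rule Lim_bounded[OF tendsto_norm[OF lim]]) (simp add: bd)
  show "norm (L x) \<le> K * norm x" by (rule le)
  show "bounded_clinear L"
  proof (rule bounded_clinearI[OF _ _ le])
    show "L (x + y) = L x + L y" for x y
      using tendsto_add[OF lim[of x] lim[of y]] lim[of "x + y"]
      by (simp add: bounded_clinear_add[OF T] LIMSEQ_unique)
    show "L (c *\<^sub>C x) = c *\<^sub>C L x" for c x
      using scaleC.tendsto[OF tendsto_const lim[of x], of c] lim[of "c *\<^sub>C x"]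
      by (simp add: bounded_clinear_scaleC[OF T] LIMSEQ_unique)
  qed
qed

section \<open>Positive operators\<close>

lemma positive_op_bounded: "positive_op T \<Longrightarrow> bounded_clinear T"
  by (simp add: positive_op_def)

lemma positive_op_Re: "positive_op T \<Longrightarrow> Re (x \<bullet>\<^sub>C T x) \<ge> 0"
  by (simp add: positive_op_def complex_nonneg_Reals_iff)

lemma positive_op_Im: "positive_op T \<Longrightarrow> Im (x \<bullet>\<^sub>C T x) = 0"
  by (simp add: positive_op_def complex_nonneg_Reals_iff)

text \<open>Polarization: reality of the form at x + y yields the imaginary part of the identity,
  reality at x + i y the real part.\<close>

lemma positive_op_symmetric:
  assumes "positive_op T"
  shows "T x \<bullet>\<^sub>C y = x \<bullet>\<^sub>C T y"
proof -
  note T = positive_op_bounded[OF assms]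
  have 1: "Im (x \<bullet>\<^sub>C T y + y \<bullet>\<^sub>C T x) = 0"
    using positive_op_Im[OF assms, of "x + y"] positive_op_Im[OF assms, of x]
      positive_op_Im[OF assms, of y]
    by (simp add: bounded_clinear_add[OF T] cinner.add_left cinner.add_right)
  have 2: "Re (x \<bullet>\<^sub>C T y - y \<bullet>\<^sub>C T x) = 0"
    using positive_op_Im[OF assms, of "x + \<i> *\<^sub>C y"] positive_op_Im[OF assms, of x]
      positive_op_Im[OF assms, of y]
    by (simp add: bounded_clinear_add[OF T] bounded_clinear_scaleC[OF T] cinner.add_left
        cinner.add_right cinner_scaleC_left cinner_scaleC_right)
  show ?thesis
    using 1 2 cinner_commute[of "T x" y] by (simp add: complex_eq_iff)
qed

lemma positive_opI:
  assumes "bounded_clinear T" "\<And>x y. T x \<bullet>\<^sub>C y = x \<bullet>\<^sub>C T y" "\<And>x. Re (x \<bullet>\<^sub>C T x) \<ge> 0"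
  shows "positive_op T"
proof -
  have "Im (x \<bullet>\<^sub>C T x) = 0" for x
    using cinner_commute[of "T x" x] assms(2)[of x x] by (simp add: complex_eq_iff)
  with assms show ?thesis by (simp add: positive_op_def complex_nonneg_Reals_iff)
qed

text \<open>This is T^2 \<le> c T. It follows from positivity at x - T x / c, and it is what makes 1
  - T / c a contraction, both for the square root and for the polar decomposition.\<close>

lemma positive_op_norm_sq_le:
  assumes T: "positive_op T" and c: "c > 0" "\<And>x. norm (T x) \<le> c * norm x"
  shows "(norm (T x))\<^sup>2 \<le> c * Re (x \<bullet>\<^sub>C T x)"
proof -
  note bT = positive_op_bounded[OF T]
  define z where "z = (1 / c) *\<^sub>R T x"
  have "0 \<le> Re ((x - z) \<bullet>\<^sub>C T (x - z))" by (rule positive_op_Re[OF T])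
  also have "\<dots> = Re (x \<bullet>\<^sub>C T x) - 2 * Re (z \<bullet>\<^sub>C T x) + Re (z \<bullet>\<^sub>C T z)"
    using positive_op_symmetric[OF T, of x z] Re_cinner_commute[of "T x" z]
    by (simp add: bounded_clinear_diff[OF bT] cinner.diff_left cinner.diff_right)
  also have "Re (z \<bullet>\<^sub>C T x) = (norm (T x))\<^sup>2 / c"
    by (simp add: z_def cinner.scaleR_left Re_cinner_self)
  also have "Re (z \<bullet>\<^sub>C T z) \<le> norm z * norm (T z)" by (rule Re_cinner_le)
  also have "\<dots> \<le> norm z * (c * norm z)" by (intro mult_left_mono c) simp
  also have "\<dots> = (norm (T x))\<^sup>2 / c"
    using c(1) by (simp add: z_def power2_eq_square field_simps)
  finally show ?thesis using c(1) by (simp add: field_simps)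
qed

lemma positive_op_square:
  "positive_op S \<Longrightarrow> (norm (S x))\<^sup>2 = Re (x \<bullet>\<^sub>C S (S x))"
  by (simp add: Re_cinner_self[symmetric] positive_op_symmetric)

section \<open>Square roots and polar decomposition\<close>

text \<open>Transfers the Cauchy property from real numbers to vectors. The square on the left is
  the form in which inner product computations deliver the estimate.\<close>

lemma convergent_if_norm_sq_diff_le:
  fixes f :: "nat \<Rightarrow> 'a::complex_hilbert"
  assumes "convergent a" and "\<And>m n. (norm (f m - f n))\<^sup>2 \<le> C * \<bar>a m - a n\<bar>"
  shows "convergent f"
proof -
  have "Cauchy f"
  proof (rule metric_CauchyI)
    fix e :: real assume e: "e > 0"
    \<comment> \<open>No sign of C is assumed; the absolute value and the added 1 keep the
      denominator positive.\<close>
    define d where "d = e\<^sup>2 / (\<bar>C\<bar> + 1)"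
    have d: "d > 0" using e by (simp add: d_def add_nonneg_pos)
    obtain M where M: "\<And>m n. m \<ge> M \<Longrightarrow> n \<ge> M \<Longrightarrow> dist (a m) (a n) < d"
      using convergent_Cauchy[OF assms(1)] d unfolding Cauchy_def by meson
    have "dist (f m) (f n) < e" if "m \<ge> M" "n \<ge> M" for m n
    proof -
      have "(norm (f m - f n))\<^sup>2 \<le> C * \<bar>a m - a n\<bar>" by (rule assms(2))
      also have "\<dots> \<le> (\<bar>C\<bar> + 1) * \<bar>a m - a n\<bar>" by (intro mult_right_mono) auto
      also have "\<dots> < (\<bar>C\<bar> + 1) * d"
        using M[OF that] by (intro mult_strict_left_mono) (auto simp: dist_real_def)
      also have "\<dots> = e\<^sup>2" by (simp add: d_def add_nonneg_eq_0_iff)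
      finally show ?thesis using e by (simp add: dist_norm power_less_imp_less_base)
    qed
    then show "\<exists>M. \<forall>m\<ge>M. \<forall>n\<ge>M. dist (f m) (f n) < e" by blast
  qed
  then show ?thesis by (rule Cauchy_convergent)
qed

text \<open>
  Iterating \<open>Y \<mapsto> (X + Y\<^sup>2) / 2\<close> from \<open>0\<close> converges to a \<open>Y\<close> with \<open>(1 - Y)\<^sup>2 = 1 - X\<close>.  The
  increments are dominated by those of the scalar iteration with \<open>X = 1\<close>.
\<close>

fun sqrt_iter :: "('a \<Rightarrow> 'a) \<Rightarrow> nat \<Rightarrow> 'a \<Rightarrow> 'a::real_vector" where
  "sqrt_iter X 0 = (\<lambda>_. 0)"
| "sqrt_iter X (Suc n) = (\<lambda>v. (1 / 2) *\<^sub>R (X v + sqrt_iter X n (sqrt_iter X n v)))"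

fun sqrt_majorant :: "nat \<Rightarrow> real" where
  "sqrt_majorant 0 = 0"
| "sqrt_majorant (Suc n) = (1 + (sqrt_majorant n)\<^sup>2) / 2"

lemma sqrt_majorant_bounds: "0 \<le> sqrt_majorant n \<and> sqrt_majorant n \<le> 1"
  by (induction n) (auto simp: power_le_one)

lemma sqrt_majorant_incseq: "incseq sqrt_majorant"
proof (rule incseq_SucI)
  fix n
  have "(sqrt_majorant n - 1)\<^sup>2 \<ge> 0" by simp
  then show "sqrt_majorant n \<le> sqrt_majorant (Suc n)" by (simp add: power2_diff)
qed

lemma convergent_sqrt_majorant: "convergent sqrt_majorant"
  by (rule Bseq_mono_convergent)
     (auto intro!: BseqI'[of _ 1] sqrt_majorant_bounds[THEN conjunct2] incseqD[OF sqrt_majorant_incseq]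
           simp: abs_of_nonneg sqrt_majorant_bounds)

context
  fixes X :: "'a::complex_hilbert \<Rightarrow> 'a"
  assumes X: "bounded_clinear X" and contr: "\<And>v. norm (X v) \<le> norm v"
begin

lemma bounded_clinear_sqrt_iter: "bounded_clinear (sqrt_iter X n)"
proof (induction n)
  case (Suc n)
  then show ?case
    using bounded_clinear_timesR[OF bounded_clinear_plus[OF X bounded_clinear_comp[OF Suc Suc]]]
    by simp
qed (simp add: bounded_clinear_zero_op)

text \<open>Each iterate is a polynomial in X. The lemma serves twice: it makes the iterates commute
  among themselves, and it gives the commutant clause for the square root.\<close>

lemma sqrt_iter_commute:
  assumes Z: "bounded_clinear Z" and comm: "\<And>v. Z (X v) = X (Z v)"
  shows "Z (sqrt_iter X n v) = sqrt_iter X n (Z v)"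
proof (induction n arbitrary: v)
  case (Suc n)
  show ?case
    by (simp add: bounded_clinear_scaleR[OF Z] bounded_clinear_add[OF Z] comm Suc
        del: scaleR_conv_of_real)
qed (simp add: bounded_clinear_zero[OF Z])

lemma sqrt_iter_sqrt_iter_commute:
  "sqrt_iter X m (sqrt_iter X n v) = sqrt_iter X n (sqrt_iter X m v)"
proof (rule sqrt_iter_commute[OF bounded_clinear_sqrt_iter])
  show "sqrt_iter X m (X v) = X (sqrt_iter X m v)" for v
    by (rule sqrt_iter_commute[OF X, symmetric]) simp
qed

lemma norm_sqrt_iter: "norm (sqrt_iter X n v) \<le> sqrt_majorant n * norm v"
proof (induction n arbitrary: v)
  case (Suc n)
  have "norm (sqrt_iter X n (sqrt_iter X n v)) \<le> sqrt_majorant n * (sqrt_majorant n * norm v)"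
    using sqrt_majorant_bounds by (intro order_trans[OF Suc] mult_left_mono Suc) auto
  then have "norm (X v + sqrt_iter X n (sqrt_iter X n v))
      \<le> norm v + sqrt_majorant n * (sqrt_majorant n * norm v)"
    using contr[of v] by (intro norm_triangle_le) linarith
  then show ?case unfolding sqrt_iter.simps norm_scaleR by (simp add: power2_eq_square algebra_simps)
qed simp

text \<open>Commuting iterates allow P^2 - N^2 = (P - N)(P + N). The scalar increments factor in the
  same way, so the induction hypothesis for the first factor and the norm bounds for the second
  reproduce the scalar recursion.\<close>

lemma norm_sqrt_iter_Suc_diff:
  "norm (sqrt_iter X (Suc n) v - sqrt_iter X n v) \<le> (sqrt_majorant (Suc n) - sqrt_majorant n) * norm v"
proof (induction n arbitrary: v)
  case 0
  show ?case using contr[of v] by simp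
next
  case (Suc n)
  let ?P = "sqrt_iter X (Suc n)" and ?N = "sqrt_iter X n"
  let ?p = "sqrt_majorant (Suc n)" and ?n = "sqrt_majorant n"
  note lin = bounded_clinear_add[OF bounded_clinear_sqrt_iter]
  let ?u = "?P v + ?N v"
  have "sqrt_iter X (Suc (Suc n)) v - ?P v = (1 / 2) *\<^sub>R (?P (?P v) - ?N (?N v))"
    unfolding sqrt_iter.simps(2)[of X "Suc n"] sqrt_iter.simps(2)[of X n, THEN fun_cong, of v]
    by (simp add: scaleR_diff_right[symmetric] del: sqrt_iter.simps(2))
  also have "?P (?P v) - ?N (?N v) = ?P ?u - ?N ?u"
    unfolding lin using sqrt_iter_sqrt_iter_commute[of "Suc n" n v] by (simp del: sqrt_iter.simps)
  finally have "norm (sqrt_iter X (Suc (Suc n)) v - ?P v) = (1 / 2) * norm (?P ?u - ?N ?u)"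
    by (simp del: sqrt_iter.simps)
  also have "\<dots> \<le> (1 / 2) * ((?p - ?n) * norm ?u)" by (intro mult_left_mono Suc) simp
  also have "\<dots> \<le> (1 / 2) * ((?p - ?n) * ((?p + ?n) * norm v))"
  proof (intro mult_left_mono)
    show "norm ?u \<le> (?p + ?n) * norm v"
      using norm_triangle_ineq[of "?P v" "?N v"] norm_sqrt_iter[of "Suc n" v] norm_sqrt_iter[of n v]
      by (simp add: distrib_right del: sqrt_iter.simps sqrt_majorant.simps)
    show "0 \<le> ?p - ?n" using incseqD[OF sqrt_majorant_incseq, of n "Suc n"] by simp
  qed simp
  also have "\<dots> = (sqrt_majorant (Suc (Suc n)) - ?p) * norm v"
    unfolding sqrt_majorant.simps(2)[of "Suc n"] sqrt_majorant.simps(2)[of n, THEN arg_cong[where f = "(-) _"]]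
    by (simp add: power2_eq_square field_simps)
  finally show ?case .
qed

lemma norm_sqrt_iter_diff:
  "norm (sqrt_iter X m v - sqrt_iter X n v) \<le> \<bar>sqrt_majorant m - sqrt_majorant n\<bar> * norm v"
proof -
  have *: "norm (sqrt_iter X (n + k) v - sqrt_iter X n v) \<le> (sqrt_majorant (n + k) - sqrt_majorant n) * norm v"
    for n k
  proof (induction k)
    case (Suc k)
    have "norm (sqrt_iter X (Suc (n + k)) v - sqrt_iter X n v)
       \<le> norm (sqrt_iter X (Suc (n + k)) v - sqrt_iter X (n + k) v) + norm (sqrt_iter X (n + k) v - sqrt_iter X n v)"
      using norm_triangle_ineq[of "sqrt_iter X (Suc (n + k)) v - sqrt_iter X (n + k) v" "sqrt_iter X (n + k) v - sqrt_iter X n v"] by simp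
    with Suc norm_sqrt_iter_Suc_diff[of "n + k" v] show ?case
      by (simp add: left_diff_distrib del: sqrt_iter.simps sqrt_majorant.simps)
  qed simp
  have mono: "sqrt_majorant n \<le> sqrt_majorant (n + k)" for n k
    by (rule incseqD[OF sqrt_majorant_incseq]) simp
  show ?thesis
  proof (cases "n \<le> m")
    case True
    then show ?thesis using *[of n "m - n"] mono[of n "m - n"] by simp
  next
    case False
    then show ?thesis using *[of m "n - m"] mono[of m "n - m"] by (simp add: norm_minus_commute)
  qed
qed

lemma convergent_sqrt_iter: "convergent (\<lambda>n. sqrt_iter X n v)"
proof (rule convergent_if_norm_sq_diff_le[OF convergent_sqrt_majorant, where C = "(norm v)\<^sup>2"])
  fix m n
  \<comment> \<open>As this difference is at most 1, its square is bounded by the difference itself,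
    which is the form the convergence criterion takes.\<close>
  let ?d = "\<bar>sqrt_majorant m - sqrt_majorant n\<bar>"
  have d: "?d \<le> 1" using sqrt_majorant_bounds[of m] sqrt_majorant_bounds[of n] by linarith
  have "(norm (sqrt_iter X m v - sqrt_iter X n v))\<^sup>2 \<le> (?d * norm v)\<^sup>2"
    by (intro power_mono norm_sqrt_iter_diff) simp
  also have "\<dots> = (norm v)\<^sup>2 * (?d * ?d)" by (simp add: power2_eq_square)
  also have "\<dots> \<le> (norm v)\<^sup>2 * (?d * 1)" using d by (intro mult_left_mono) auto
  finally show "(norm (sqrt_iter X m v - sqrt_iter X n v))\<^sup>2 \<le> (norm v)\<^sup>2 * ?d" by simp
qed

end

text \<open>The root is 1 - Y for the limit Y of the iteration started with X = 1 - T. The commutant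
  clause is what later carries commutation with A_x over to its square root.\<close>

lemma positive_sqrt_contraction:
  fixes T :: "'a::complex_hilbert \<Rightarrow> 'a"
  assumes T: "positive_op T" and contr: "\<And>v. norm (T v) \<le> norm v"
  shows "\<exists>S. positive_op S \<and> S \<circ> S = T \<and>
    (\<forall>Z. bounded_clinear Z \<longrightarrow> Z \<circ> T = T \<circ> Z \<longrightarrow> Z \<circ> S = S \<circ> Z)"
proof -
  note bT = positive_op_bounded[OF T]
  define X where "X = (\<lambda>v. v - T v)"
  have bX: "bounded_clinear X"
    using bounded_clinear_minus[OF bounded_clinear_id bT] by (simp add: X_def)
  have X_contr: "norm (X v) \<le> norm v" for v
  proof -
    \<comment> \<open>Expanding the square leaves |v|^2 - 2 <v, T v> + |T v|^2, and T^2 \<le> T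
      absorbs the last term.\<close>
    have "(norm (X v))\<^sup>2 \<le> (norm v)\<^sup>2"
      using positive_op_norm_sq_le[OF T, of 1 v] contr positive_op_Re[OF T, of v]
      by (simp add: X_def norm_diff_sq)
    then show ?thesis by simp
  qed
  note bI = bounded_clinear_sqrt_iter[OF bX X_contr]
  define Y where "Y v = lim (\<lambda>n. sqrt_iter X n v)" for v
  have Y: "(\<lambda>n. sqrt_iter X n v) \<longlonglongrightarrow> Y v" for v
    unfolding Y_def using convergent_sqrt_iter[OF bX X_contr] by (simp add: convergent_LIMSEQ_iff)
  have I_contr: "norm (sqrt_iter X n v) \<le> 1 * norm v" for n v
    using norm_sqrt_iter[OF bX X_contr, of n v] mult_right_mono[OF sqrt_majorant_bounds[THEN conjunct2, of n], of "norm v"]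
    by simp
  have bY: "bounded_clinear Y" and Y_contr: "norm (Y v) \<le> norm v" for v
    using bounded_clinear_lim[OF bI Y I_contr] by simp_all
  have X_sym: "X v \<bullet>\<^sub>C w = v \<bullet>\<^sub>C X w" for v w
    by (simp add: X_def cinner.diff_left cinner.diff_right positive_op_symmetric[OF T])
  have I_sym: "sqrt_iter X n v \<bullet>\<^sub>C w = v \<bullet>\<^sub>C sqrt_iter X n w" for n v w
    by (induction n arbitrary: v w)
      (simp_all add: cinner.add_left cinner.add_right cinner.scaleR_left cinner.scaleR_right
          cinner.zero_left cinner.zero_right X_sym)
  have Y_sym: "Y v \<bullet>\<^sub>C w = v \<bullet>\<^sub>C Y w" for v w
    using cinner.tendsto[OF Y[of v] tendsto_const[of w]] cinner.tendsto[OF tendsto_const[of v] Y[of w]]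
    by (simp add: I_sym LIMSEQ_unique)
  have YY: "Y v = (1 / 2) *\<^sub>R (X v + Y (Y v))" for v
  proof (rule LIMSEQ_unique)
    show "(\<lambda>n. sqrt_iter X (Suc n) v) \<longlonglongrightarrow> Y v" using Y by (rule LIMSEQ_Suc)
    \<comment> \<open>Operator and argument both vary with n. The uniform bound on the iterates
      disposes of the change in the argument, leaving pointwise convergence at Y v.\<close>
    have "(\<lambda>n. sqrt_iter X n (sqrt_iter X n v - Y v)) \<longlonglongrightarrow> 0"
    proof (rule Lim_null_comparison)
      show "\<forall>\<^sub>F n in sequentially. norm (sqrt_iter X n (sqrt_iter X n v - Y v)) \<le> norm (sqrt_iter X n v - Y v)"
        using I_contr by simp
      show "(\<lambda>n. norm (sqrt_iter X n v - Y v)) \<longlonglongrightarrow> 0"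
        using tendsto_norm[OF tendsto_diff[OF Y[of v] tendsto_const[of "Y v"]]] by simp
    qed
    from tendsto_add[OF this Y[of "Y v"]] have "(\<lambda>n. sqrt_iter X n (sqrt_iter X n v)) \<longlonglongrightarrow> Y (Y v)"
      by (simp add: bounded_clinear_diff[OF bI])
    then show "(\<lambda>n. sqrt_iter X (Suc n) v) \<longlonglongrightarrow> (1 / 2) *\<^sub>R (X v + Y (Y v))"
      by (auto intro!: tendsto_intros)
  qed
  define S where "S = (\<lambda>v. v - Y v)"
  have bS: "bounded_clinear S"
    using bounded_clinear_minus[OF bounded_clinear_id bY] by (simp add: S_def)
  have "positive_op S"
  proof (rule positive_opI[OF bS])
    show "S x \<bullet>\<^sub>C y = x \<bullet>\<^sub>C S y" for x y
      by (simp add: S_def cinner.diff_left cinner.diff_right Y_sym)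
    show "Re (x \<bullet>\<^sub>C S x) \<ge> 0" for x
      using Re_cinner_le[of x "Y x"] mult_left_mono[OF Y_contr[of x], of "norm x"]
      by (simp add: S_def cinner.diff_right Re_cinner_self power2_eq_square)
  qed
  moreover have "S (S v) = T v" for v
  proof -
    have "2 *\<^sub>R Y v = X v + Y (Y v)" using arg_cong[OF YY[of v], of "\<lambda>w. 2 *\<^sub>R w"] by simp
    then have "Y v + Y v = v - T v + Y (Y v)" by (simp add: X_def scaleR_2)
    then show ?thesis by (simp add: S_def bounded_clinear_diff[OF bY] algebra_simps)
  qed
  moreover have "Z (S v) = S (Z v)" if Z: "bounded_clinear Z" "Z \<circ> T = T \<circ> Z" for Z v
  proof -
    have "Z (X v) = X (Z v)" for v
      using fun_cong[OF Z(2), of v] by (simp add: X_def bounded_clinear_diff[OF Z(1)])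
    note comm = sqrt_iter_commute[OF bX X_contr Z(1) this]
    interpret Z: bounded_linear Z by (rule bounded_clinear_linear[OF Z(1)])
    have "(\<lambda>n. Z (sqrt_iter X n v)) \<longlonglongrightarrow> Z (Y v)" by (intro Z.tendsto Y)
    then have "Z (Y v) = Y (Z v)" unfolding comm using Y[of "Z v"] by (rule LIMSEQ_unique)
    then show ?thesis by (simp add: S_def bounded_clinear_diff[OF Z(1)])
  qed
  ultimately show ?thesis by (intro exI[of _ S]) (auto simp: fun_eq_iff)
qed

lemma positive_op_scaleR:
  assumes "positive_op T" "r \<ge> 0"
  shows "positive_op (\<lambda>v. r *\<^sub>R T v)"
  using assms
  by (intro positive_opI bounded_clinear_timesR)
     (auto simp: positive_op_bounded cinner.scaleR_left cinner.scaleR_right positive_op_symmetric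
        positive_op_Re)

lemma positive_sqrt_exists:
  fixes T :: "'a::complex_hilbert \<Rightarrow> 'a"
  assumes T: "positive_op T"
  shows "\<exists>S. positive_op S \<and> S \<circ> S = T \<and>
    (\<forall>Z. bounded_clinear Z \<longrightarrow> Z \<circ> T = T \<circ> Z \<longrightarrow> Z \<circ> S = S \<circ> Z)"
proof -
  obtain K where K: "K > 0" "\<And>x. norm (T x) \<le> K * norm x"
    using bounded_clinear_bound[OF positive_op_bounded[OF T]] by blast
  define T' where "T' = (\<lambda>v. (1 / K) *\<^sub>R T v)"
  have "positive_op T'" unfolding T'_def using K by (intro positive_op_scaleR[OF T]) simp
  moreover have "norm (T' v) \<le> norm v" for v
    using K(1) K(2)[of v] by (simp add: T'_def field_simps)
  ultimately obtain S where S: "positive_op S" "S \<circ> S = T'"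
    "\<And>Z. bounded_clinear Z \<Longrightarrow> Z \<circ> T' = T' \<circ> Z \<Longrightarrow> Z \<circ> S = S \<circ> Z"
    using positive_sqrt_contraction[of T'] by blast
  note bS = positive_op_bounded[OF S(1)]
  have "(\<lambda>v. sqrt K *\<^sub>R S v) \<circ> (\<lambda>v. sqrt K *\<^sub>R S v) = T"
    using fun_cong[OF S(2)] K(1) by (auto simp: fun_eq_iff bounded_clinear_scaleR[OF bS] T'_def)
  moreover have "Z \<circ> (\<lambda>v. sqrt K *\<^sub>R S v) = (\<lambda>v. sqrt K *\<^sub>R S v) \<circ> Z"
    if Z: "bounded_clinear Z" "Z \<circ> T = T \<circ> Z" for Z
  proof -
    have "Z \<circ> T' = T' \<circ> Z"
      using fun_cong[OF Z(2)] by (auto simp: fun_eq_iff T'_def bounded_clinear_scaleR[OF Z(1)])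
    from fun_cong[OF S(3)[OF Z(1) this]] show ?thesis
      by (auto simp: fun_eq_iff bounded_clinear_scaleR[OF Z(1)])
  qed
  ultimately show ?thesis
    using positive_op_scaleR[OF S(1), of "sqrt K"] K(1)
    by (intro exI[of _ "\<lambda>v. sqrt K *\<^sub>R S v"]) auto
qed

text \<open>
  The partial isometry is the strong limit of \<open>R J\<^sub>2\<^sub>n\<close>, where \<open>J\<^sub>m\<close> is the partial sum of the
  Neumann series for the inverse of \<open>Q\<close>: with \<open>D = 1 - Q / c\<close> one has \<open>J\<^sub>m Q = 1 - D\<^sup>m\<close>.
\<close>

lemma polar_decomposition:
  fixes R Q :: "'a::complex_hilbert \<Rightarrow> 'a"
  assumes R: "bounded_clinear R" and Q: "positive_op Q"
    and RQ: "\<And>x y. R x \<bullet>\<^sub>C R y = Q x \<bullet>\<^sub>C Q y"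
  shows "\<exists>U. bounded_clinear U \<and> R = U \<circ> Q \<and> (\<forall>x y. U x \<bullet>\<^sub>C R y = x \<bullet>\<^sub>C Q y)"
proof -
  note bQ = positive_op_bounded[OF Q] and sym = positive_op_symmetric[OF Q]
  obtain c where c: "c > 0" "\<And>x. norm (Q x) \<le> c * norm x"
    using bounded_clinear_bound[OF bQ] by blast
  define D where "D = (\<lambda>x. x - (1 / c) *\<^sub>R Q x)"
  have bD: "bounded_clinear D"
    using bounded_clinear_minus[OF bounded_clinear_id bounded_clinear_timesR[OF bQ]]
    by (simp add: D_def)
  have bDn: "bounded_clinear (D ^^ n)" for n
    proof (induction n)
    case (Suc n)
    then show ?case unfolding funpow.simps by (rule bounded_clinear_comp[OF bD])
  qed (unfold funpow.simps, rule bounded_clinear_id)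
  have D_sym: "D x \<bullet>\<^sub>C y = x \<bullet>\<^sub>C D y" for x y
    by (simp add: D_def cinner.diff_left cinner.diff_right cinner.scaleR_left cinner.scaleR_right sym)
  have Dn_sym: "(D ^^ n) x \<bullet>\<^sub>C y = x \<bullet>\<^sub>C (D ^^ n) y" for n x y
    by (induction n arbitrary: x y) (simp_all add: D_sym funpow_swap1)
  have QD: "Q (D x) = D (Q x)" for x
    by (simp add: D_def bounded_clinear_diff[OF bQ] bounded_clinear_scaleR[OF bQ])
  have QDn: "Q ((D ^^ n) x) = (D ^^ n) (Q x)" for n x
    by (induction n) (simp_all add: QD)
  \<comment> \<open>The deficit |Q x|^2 / c^2 matters as well as the contraction: it telescopes
    along the powers of D.\<close>
  have D_norm: "(norm (D x))\<^sup>2 \<le> (norm x)\<^sup>2 - (norm (Q x))\<^sup>2 / c\<^sup>2" for x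
  proof -
    have "(norm (Q x))\<^sup>2 / c \<le> Re (x \<bullet>\<^sub>C Q x)"
      using positive_op_norm_sq_le[OF Q c, of x] c(1) by (simp add: field_simps)
    from mult_left_mono[OF this, of "2 / c"]
    have "2 * (norm (Q x))\<^sup>2 / c\<^sup>2 \<le> 2 / c * Re (x \<bullet>\<^sub>C Q x)"
      using c(1) by (simp add: power2_eq_square)
    then show ?thesis
      using c(1) by (simp add: D_def norm_diff_sq cinner.scaleR_right power_divide)
  qed
  have "decseq (\<lambda>n. (norm ((D ^^ n) x))\<^sup>2)" for x
  proof (rule decseq_SucI)
    show "(norm ((D ^^ Suc n) x))\<^sup>2 \<le> (norm ((D ^^ n) x))\<^sup>2" for n
      using D_norm[of "(D ^^ n) x"] by (smt (verit) funpow.simps(2) o_apply zero_le_divide_iff zero_le_power2)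
  qed
  note dec = this
  have conv: "convergent (\<lambda>n. (norm ((D ^^ n) x))\<^sup>2)" for x
    using decseq_convergent[OF dec[of x], of 0] by (auto simp: convergent_def)
  have Dn_le: "norm ((D ^^ n) x) \<le> norm x" for n x
    using decseqD[OF dec[of x], of 0 n] by simp
  \<comment> \<open>By the deficit, |Q D^n x|^2 is at most c^2 times a difference of consecutive
    terms of a convergent sequence.\<close>
  have Q_Dn: "(\<lambda>n. Q ((D ^^ n) x)) \<longlonglongrightarrow> 0" for x
  proof -
    obtain l where l: "(\<lambda>n. (norm ((D ^^ n) x))\<^sup>2) \<longlonglongrightarrow> l" using conv by (auto simp: convergent_def)
    have "(\<lambda>n. (norm (Q ((D ^^ n) x)))\<^sup>2) \<longlonglongrightarrow> 0"
    proof (rule Lim_null_comparison[OF always_eventually])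
      show "(\<lambda>n. c\<^sup>2 * ((norm ((D ^^ n) x))\<^sup>2 - (norm ((D ^^ Suc n) x))\<^sup>2)) \<longlonglongrightarrow> 0"
        using tendsto_mult_left[OF tendsto_diff[OF l LIMSEQ_Suc[OF l]], of "c\<^sup>2"] by simp
      show "\<forall>n. norm ((norm (Q ((D ^^ n) x)))\<^sup>2) \<le> c\<^sup>2 * ((norm ((D ^^ n) x))\<^sup>2 - (norm ((D ^^ Suc n) x))\<^sup>2)"
        using D_norm[of "(D ^^ n) x" for n] c(1) by (simp add: field_simps)
    qed
    from tendsto_real_sqrt[OF this] show ?thesis by (simp add: tendsto_norm_zero_iff)
  qed
  \<comment> \<open>Even powers, because then the inner product of the m-th and n-th terms is
    |D^(m+n) x|^2. Distances thus involve only the decreasing sequence a; odd exponents would give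
    forms in D of unknown sign.\<close>
  have conv2: "convergent (\<lambda>n. (D ^^ (2 * n)) x)" for x
  proof -
    define a where "a n = (norm ((D ^^ n) x))\<^sup>2" for n
    have inner: "Re ((D ^^ (2 * m)) x \<bullet>\<^sub>C (D ^^ (2 * n)) x) = a (m + n)" for m n
    proof -
      have "(D ^^ (2 * m)) x \<bullet>\<^sub>C (D ^^ (2 * n)) x = x \<bullet>\<^sub>C (D ^^ (2 * m + 2 * n)) x"
        unfolding funpow_add o_apply by (rule Dn_sym)
      also have "2 * m + 2 * n = (m + n) + (m + n)" by simp
      also have "x \<bullet>\<^sub>C (D ^^ ((m + n) + (m + n))) x = (D ^^ (m + n)) x \<bullet>\<^sub>C (D ^^ (m + n)) x"
        unfolding funpow_add[of "m + n" "m + n"] o_apply by (rule Dn_sym[symmetric])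
      finally show ?thesis by (simp add: a_def Re_cinner_self)
    qed
    have "(norm ((D ^^ (2 * m)) x - (D ^^ (2 * n)) x))\<^sup>2 \<le> 1 * \<bar>a (2 * m) - a (2 * n)\<bar>" for m n
    proof -
      have eq: "(norm ((D ^^ (2 * m)) x - (D ^^ (2 * n)) x))\<^sup>2 = a (2 * m) - 2 * a (m + n) + a (2 * n)"
        unfolding norm_diff_sq inner by (simp add: a_def)
      have "a (m + n) \<ge> a (2 * max m n)"
        unfolding a_def by (rule decseqD[OF dec]) (simp add: max_def)
      then show ?thesis unfolding eq by (auto simp: max_def split: if_splits)
    qed
    moreover have "convergent (\<lambda>n. a (2 * n))"
    proof -
      obtain l where "a \<longlonglongrightarrow> l" using conv unfolding a_def by (auto simp: convergent_def)
      then show ?thesis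
        using LIMSEQ_subseq_LIMSEQ[of a l "\<lambda>n. 2 * n"] by (auto simp: convergent_def o_def strict_mono_def)
    qed
    ultimately show ?thesis by (intro convergent_if_norm_sq_diff_le)
  qed
  define J where "J m x = (1 / c) *\<^sub>R (\<Sum>k<m. (D ^^ k) x)" for m x
  have bJ: "bounded_clinear (J m)" for m
    unfolding J_def[abs_def] by (intro bounded_clinear_timesR bounded_clinear_sum bDn)
  have JQ: "J m (Q x) = x - (D ^^ m) x" for m x
  proof (induction m)
    case (Suc m)
    have "J (Suc m) (Q x) = J m (Q x) + (1 / c) *\<^sub>R Q ((D ^^ m) x)"
      by (simp add: J_def scaleR_add_right QDn)
    also have "(1 / c) *\<^sub>R Q ((D ^^ m) x) = (D ^^ m) x - (D ^^ Suc m) x" by (simp add: D_def)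
    finally show ?case using Suc by simp
  qed (simp add: J_def)
  have QJ: "Q (J m x) = x - (D ^^ m) x" for m x
  proof -
    have "Q (J m x) = J m (Q x)"
      by (simp add: J_def bounded_clinear_scaleR[OF bQ] QDn[symmetric]
          linear_sum[OF bounded_linear.linear[OF bounded_clinear_linear[OF bQ]]])
    then show ?thesis by (simp add: JQ)
  qed
  have norm_R: "norm (R x) = norm (Q x)" for x
    using RQ[of x x] by (simp add: cinner_self del: of_real_power)
  \<comment> \<open>\<open>J (2 * n) x\<close> itself need not converge, as Q need not be
    invertible. R preserves exactly the norms seen by Q, and Q J_m = 1 - D^m.\<close>
  have convU: "convergent (\<lambda>n. R (J (2 * n) x))" for x
  proof -
    have "Cauchy (\<lambda>n. (D ^^ (2 * n)) x)" by (rule convergent_Cauchy[OF conv2])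
    moreover have "norm (R (J (2 * m) x) - R (J (2 * n) x)) = norm ((D ^^ (2 * m)) x - (D ^^ (2 * n)) x)" for m n
      by (simp add: bounded_clinear_diff[OF R, symmetric] norm_R bounded_clinear_diff[OF bQ] QJ norm_minus_commute)
    ultimately have "Cauchy (\<lambda>n. R (J (2 * n) x))" by (simp add: Cauchy_def dist_norm)
    then show ?thesis by (rule Cauchy_convergent)
  qed
  define U where "U x = lim (\<lambda>n. R (J (2 * n) x))" for x
  have U: "(\<lambda>n. R (J (2 * n) x)) \<longlonglongrightarrow> U x" for x
    unfolding U_def using convU by (simp add: convergent_LIMSEQ_iff)
  have le: "norm (R (J (2 * n) x)) \<le> 2 * norm x" for n x
    using norm_triangle_ineq4[of x "(D ^^ (2 * n)) x"] Dn_le[of "2 * n" x] by (simp add: norm_R QJ)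
  have bU: "bounded_clinear U"
    by (rule bounded_clinear_lim(1)[OF _ U le])
       (use bounded_clinear_comp[OF R bJ] in \<open>simp add: o_def\<close>)
  have sub: "(\<lambda>n. f (2 * n)) \<longlonglongrightarrow> l" if "f \<longlonglongrightarrow> l" for f :: "nat \<Rightarrow> 'b::topological_space" and l
    using LIMSEQ_subseq_LIMSEQ[OF that, of "\<lambda>n. 2 * n"] by (simp add: o_def strict_mono_def)
  have "R x = U (Q x)" for x
  proof (rule LIMSEQ_unique)
    show "(\<lambda>n. R (J (2 * n) (Q x))) \<longlonglongrightarrow> U (Q x)" by (rule U)
    have "(\<lambda>n. R ((D ^^ n) x)) \<longlonglongrightarrow> 0"
      using tendsto_norm_zero[OF Q_Dn[of x]] unfolding norm_R[symmetric] by (rule tendsto_norm_zero_cancel)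
    from tendsto_diff[OF tendsto_const[of "R x"] sub[OF this]]
    show "(\<lambda>n. R (J (2 * n) (Q x))) \<longlonglongrightarrow> R x" by (simp add: JQ bounded_clinear_diff[OF R])
  qed
  moreover have "U x \<bullet>\<^sub>C R y = x \<bullet>\<^sub>C Q y" for x y
  proof (rule LIMSEQ_unique)
    show "(\<lambda>n. R (J (2 * n) x) \<bullet>\<^sub>C R y) \<longlonglongrightarrow> U x \<bullet>\<^sub>C R y" by (intro cinner.tendsto U tendsto_const)
    have "(\<lambda>n. Q ((D ^^ n) x) \<bullet>\<^sub>C y) \<longlonglongrightarrow> 0 \<bullet>\<^sub>C y" by (intro cinner.tendsto Q_Dn tendsto_const)
    from tendsto_diff[OF tendsto_const[of "x \<bullet>\<^sub>C Q y"] sub[OF this]]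
    show "(\<lambda>n. R (J (2 * n) x) \<bullet>\<^sub>C R y) \<longlonglongrightarrow> x \<bullet>\<^sub>C Q y"
      by (simp add: RQ QJ cinner.diff_left cinner.zero_left sym)
  qed
  ultimately show ?thesis using bU by (intro exI[of _ U]) (auto simp: fun_eq_iff)
qed

section \<open>Unconditional sums\<close>

text \<open>A Cauchy criterion for the net of finite partial sums. It covers series such as
  orthogonal expansions whose norms need not be summable, only their squares.\<close>

lemma summable_on_norm_sq_dominated:
  fixes f :: "'b \<Rightarrow> 'a::banach" and g :: "'b \<Rightarrow> real"
  assumes g: "g summable_on A" "\<And>x. x \<in> A \<Longrightarrow> g x \<ge> 0"
    and le: "\<And>F. finite F \<Longrightarrow> F \<subseteq> A \<Longrightarrow> (norm (sum f F))\<^sup>2 \<le> C * sum g F"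
  shows "f summable_on A"
proof -
  have "\<exists>P. eventually P (finite_subsets_at_top A) \<and>
      (\<forall>F F'. P F \<and> P F' \<longrightarrow> dist (sum f F) (sum f F') < e)" if e: "e > 0" for e
  proof -
    \<comment> \<open>Half of e, since two partial sums are compared through the common reference
      set \<open>F0\<close>.\<close>
    define d where "d = (e / 2)\<^sup>2 / (\<bar>C\<bar> + 1)"
    have d: "d > 0" using e by (simp add: d_def add_nonneg_pos)
    obtain F0 where F0: "finite F0" "F0 \<subseteq> A" "dist (sum g F0) (infsum g A) < d"
      using infsum_finite_approximation[OF g(1), of "d / 2"] d by (metis field_sum_of_halves
          less_add_same_cancel1 half_gt_zero order_le_less_trans)
    define P where "P F \<longleftrightarrow> finite F \<and> F0 \<subseteq> F \<and> F \<subseteq> A" for F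
    have small: "dist (sum f F) (sum f F0) < e / 2" if "P F" for F
    proof -
      have F: "finite F" "F0 \<subseteq> F" "F \<subseteq> A" using that by (auto simp: P_def)
      have "sum g (F - F0) = sum g F - sum g F0" using F by (simp add: sum_diff)
      also have "\<dots> \<le> infsum g A - sum g F0"
        using finite_sum_le_infsum[OF g(1) F(1,3)] g(2) by simp
      also have "\<dots> < d" using F0(3) by (auto simp: dist_real_def)
      finally have small_g: "sum g (F - F0) < d" .
      have g_nonneg: "sum g (F - F0) \<ge> 0" using F g(2) by (intro sum_nonneg) auto
      have "(dist (sum f F) (sum f F0))\<^sup>2 = (norm (sum f (F - F0)))\<^sup>2"
        using F F0 by (simp add: dist_norm sum_diff)
      also have "\<dots> \<le> C * sum g (F - F0)" using F by (intro le) auto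
      also have "\<dots> \<le> (\<bar>C\<bar> + 1) * sum g (F - F0)" using g_nonneg by (intro mult_right_mono) auto
      also have "\<dots> < (\<bar>C\<bar> + 1) * d" using small_g by (intro mult_strict_left_mono) auto
      also have "\<dots> = (e / 2)\<^sup>2" by (simp add: d_def add_nonneg_eq_0_iff)
      finally show ?thesis by (rule power_less_imp_less_base) (use e in simp)
    qed
    have "eventually P (finite_subsets_at_top A)"
      unfolding eventually_finite_subsets_at_top P_def using F0 by blast
    moreover have "dist (sum f F) (sum f F') < e" if "P F" "P F'" for F F'
      using small[OF that(1)] small[OF that(2)] dist_triangle2[of "sum f F" "sum f F'" "sum f F0"]
      by linarith
    ultimately show ?thesis by blast
  qed
  then have "cauchy_filter (filtermap (sum f) (finite_subsets_at_top A))"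
    by (simp add: cauchy_filter_metric_filtermap)
  moreover have "complete (UNIV::'a set)"
    by (meson Cauchy_convergent UNIV_I complete_def convergent_def)
  ultimately obtain L where "(sum f \<longlongrightarrow> L) (finite_subsets_at_top A)"
    using complete_uniform[where S=UNIV] by (force simp add: filterlim_def)
  then show ?thesis using summable_on_def has_sum_def by blast
qed

text \<open>Fubini for unconditional sums: both iterated sums equal the sum over the product. Joint
  summability is the hypothesis that costs work in the applications.\<close>

lemma has_sum_exchange:
  fixes f :: "'b \<Rightarrow> 'c \<Rightarrow> 'd::banach"
  assumes f: "(\<lambda>(x, y). f x y) summable_on A \<times> B"
    and row: "\<And>x. x \<in> A \<Longrightarrow> (f x has_sum r x) B"
    and col: "\<And>y. y \<in> B \<Longrightarrow> ((\<lambda>x. f x y) has_sum c y) A"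
  shows "r summable_on A" "c summable_on B" "infsum r A = infsum c B"
proof -
  let ?S = "infsum (\<lambda>(x, y). f x y) (A \<times> B)"
  have S: "((\<lambda>(x, y). f x y) has_sum ?S) (A \<times> B)" using f by simp
  then have "((\<lambda>(y, x). f x y) has_sum ?S) (B \<times> A)"
    unfolding has_sum_swap[of "\<lambda>(x, y). f x y"] by simp
  from has_sum_SigmaD[OF this, of c] have c: "(c has_sum ?S) B" using col by simp
  from has_sum_SigmaD[OF S, of r] have r: "(r has_sum ?S) A" using row by simp
  show "r summable_on A" "c summable_on B" "infsum r A = infsum c B"
    using r c by (auto simp: has_sum_iff)
qed

lemma summable_on_dominated:
  fixes f :: "'b \<Rightarrow> 'd::banach"
  assumes "g summable_on A" "\<And>x. x \<in> A \<Longrightarrow> norm (f x) \<le> g x"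
  shows "f summable_on A"
  by (rule abs_summable_summable) (rule Infinite_Sum.abs_summable_on_comparison_test'[OF assms])

lemma summable_on_Times_dominated:
  fixes f :: "'b \<Rightarrow> 'c \<Rightarrow> 'd::banach" and g :: "'b \<Rightarrow> 'c \<Rightarrow> real"
  assumes "(\<lambda>(x, y). g x y) summable_on A \<times> B"
    and "\<And>x y. x \<in> A \<Longrightarrow> y \<in> B \<Longrightarrow> norm (f x y) \<le> g x y"
  shows "(\<lambda>(x, y). f x y) summable_on A \<times> B"
  by (rule summable_on_dominated[OF assms(1)]) (use assms(2) in auto)

lemma summable_on_Times_nonneg:
  fixes f :: "'b \<Rightarrow> 'c \<Rightarrow> real"
  assumes "\<And>x. x \<in> A \<Longrightarrow> (f x has_sum r x) B" "r summable_on A" "\<And>x y. f x y \<ge> 0"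
  shows "(\<lambda>(x, y). f x y) summable_on A \<times> B"
  by (rule summable_on_SigmaI[where g = r]) (use assms in auto)

lemma summable_on_Times_swap:
  "(\<lambda>(x, y). f x y) summable_on A \<times> B \<Longrightarrow> (\<lambda>(y, x). f x y) summable_on B \<times> A"
  unfolding summable_on_swap[of "\<lambda>(x, y). f x y"] by simp

section \<open>Orthonormal bases and adjoints\<close>

lemma is_onb_cinner:
  "is_onb E \<Longrightarrow> e \<in> E \<Longrightarrow> f \<in> E \<Longrightarrow> e \<bullet>\<^sub>C f = (if e = f then 1 else 0)"
  by (auto simp: is_onb_def cinner_self)

lemma norm_sq_sum_onb:
  assumes E: "is_onb E" and F: "finite F" "F \<subseteq> E"
  shows "(norm (\<Sum>e\<in>F. c e *\<^sub>C e))\<^sup>2 = (\<Sum>e\<in>F. (cmod (c e))\<^sup>2)"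
proof -
  let ?s = "\<Sum>e\<in>F. c e *\<^sub>C e"
  have "e \<bullet>\<^sub>C ?s = c e" if "e \<in> F" for e
  proof -
    have "e \<bullet>\<^sub>C ?s = (\<Sum>f\<in>F. c f * (if e = f then 1 else 0))"
      unfolding cinner.sum_right cinner_scaleC_right
      using F that by (intro sum.cong refl) (auto simp: is_onb_cinner[OF E] subset_iff)
    then show ?thesis using F(1) that by (simp add: if_distrib cong: if_cong)
  qed
  then have "?s \<bullet>\<^sub>C ?s = (\<Sum>e\<in>F. complex_of_real ((cmod (c e))\<^sup>2))"
    by (subst cinner.sum_left)
       (simp add: cinner_scaleC_left complex_norm_square mult.commute del: of_real_power)
  then show ?thesis unfolding cinner_self of_real_sum[symmetric] of_real_eq_iff .
qed

lemma summable_onb_coefficients: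
  assumes E: "is_onb E" and le: "\<And>F. finite F \<Longrightarrow> F \<subseteq> E \<Longrightarrow> (\<Sum>e\<in>F. (cmod (c e))\<^sup>2) \<le> C"
  shows "(\<lambda>e. (cmod (c e))\<^sup>2) summable_on E" "(\<lambda>e. c e *\<^sub>C e) summable_on E"
proof -
  show *: "(\<lambda>e. (cmod (c e))\<^sup>2) summable_on E"
    by (rule nonneg_bdd_above_summable_on) (auto intro!: bdd_aboveI2[of _ _ C] le)
  show "(\<lambda>e. c e *\<^sub>C e) summable_on E"
    by (rule summable_on_norm_sq_dominated[OF *, where C = 1]) (simp_all add: norm_sq_sum_onb[OF E])
qed

lemma cinner_has_sum_right:
  "(f has_sum s) A \<Longrightarrow> ((\<lambda>x. u \<bullet>\<^sub>C f x) has_sum u \<bullet>\<^sub>C s) A"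
  by (rule has_sum_bounded_linear[OF cinner.bounded_linear_right])

lemma cinner_has_sum_left:
  "(f has_sum s) A \<Longrightarrow> ((\<lambda>x. f x \<bullet>\<^sub>C u) has_sum s \<bullet>\<^sub>C u) A"
  by (rule has_sum_bounded_linear[OF cinner.bounded_linear_left])

lemma cinner_onb_sum:
  assumes E: "is_onb E" and s: "((\<lambda>e. c e *\<^sub>C e) has_sum s) E" and e: "e \<in> E"
  shows "e \<bullet>\<^sub>C s = c e"
proof -
  have "((\<lambda>f. e \<bullet>\<^sub>C (c f *\<^sub>C f)) has_sum e \<bullet>\<^sub>C s) E" by (rule cinner_has_sum_right[OF s])
  moreover have "((\<lambda>f. e \<bullet>\<^sub>C (c f *\<^sub>C f)) has_sum c e) E"
    by (rule has_sum_finite_neutralI[of "{e}"])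
       (use e in \<open>auto simp: cinner_scaleC_right is_onb_cinner[OF E]\<close>)
  ultimately show ?thesis by (rule has_sum_unique)
qed

lemma onb_eqI:
  assumes "is_onb E" "\<And>e. e \<in> E \<Longrightarrow> e \<bullet>\<^sub>C x = e \<bullet>\<^sub>C y"
  shows "x = y"
proof -
  have "\<forall>e\<in>E. e \<bullet>\<^sub>C (x - y) = 0" using assms(2) by (simp add: cinner.diff_right)
  then have "x - y = 0" using assms(1) unfolding is_onb_def by blast
  then show ?thesis by simp
qed

lemma bessel:
  assumes E: "is_onb E" and F: "finite F" "F \<subseteq> E"
  shows "(\<Sum>e\<in>F. (cmod (e \<bullet>\<^sub>C x))\<^sup>2) \<le> (norm x)\<^sup>2"
proof -
  let ?s = "\<Sum>e\<in>F. (e \<bullet>\<^sub>C x) *\<^sub>C e" and ?S = "\<Sum>e\<in>F. (cmod (e \<bullet>\<^sub>C x))\<^sup>2"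
  have "?s \<bullet>\<^sub>C x = (\<Sum>e\<in>F. complex_of_real ((cmod (e \<bullet>\<^sub>C x))\<^sup>2))"
    unfolding cinner.sum_left cinner_scaleC_left by (simp add: complex_norm_square mult.commute del: of_real_power)
  then have "Re (?s \<bullet>\<^sub>C x) = ?S" by (simp add: Re_sum)
  then have "(norm (?s - x))\<^sup>2 = (norm x)\<^sup>2 - ?S"
    by (simp add: norm_diff_sq norm_sq_sum_onb[OF E F])
  then show ?thesis using zero_le_power2[of "norm (?s - x)"] by linarith
qed

text \<open>\<open>is_onb\<close> expresses completeness only by the absence of nonzero orthogonal
  vectors. Bessel makes the series converge, and its sum has the same coefficients as x.\<close>

lemma onb_expansion:
  assumes E: "is_onb E"
  shows "((\<lambda>e. (e \<bullet>\<^sub>C x) *\<^sub>C e) has_sum x) E"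
proof -
  have "(\<lambda>e. (e \<bullet>\<^sub>C x) *\<^sub>C e) summable_on E"
    using summable_onb_coefficients(2)[OF E bessel[OF E]] .
  then obtain s where s: "((\<lambda>e. (e \<bullet>\<^sub>C x) *\<^sub>C e) has_sum s) E" by (auto simp: summable_on_def)
  have "s = x" by (rule onb_eqI[OF E], rule cinner_onb_sum[OF E s])
  with s show ?thesis by simp
qed

lemma parseval_cinner:
  assumes "is_onb E"
  shows "((\<lambda>e. (x \<bullet>\<^sub>C e) * (e \<bullet>\<^sub>C y)) has_sum x \<bullet>\<^sub>C y) E"
  using cinner_has_sum_right[OF onb_expansion[OF assms, of y], of x]
  by (simp add: cinner_scaleC_right mult.commute)

lemma cmod_cinner_commute: "cmod (x \<bullet>\<^sub>C y) = cmod (y \<bullet>\<^sub>C (x::'a::complex_hilbert))"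
  using cinner_commute[of x y] by simp

lemma parseval:
  assumes "is_onb E"
  shows "((\<lambda>e. (cmod (e \<bullet>\<^sub>C x))\<^sup>2) has_sum (norm x)\<^sup>2) E"
proof -
  have "(x \<bullet>\<^sub>C e) * (e \<bullet>\<^sub>C x) = complex_of_real ((cmod (e \<bullet>\<^sub>C x))\<^sup>2)" for e
    using cinner_commute[of x e] by (simp add: complex_norm_square mult.commute del: of_real_power)
  then show ?thesis
    using has_sum_Re[OF parseval_cinner[OF assms, of x x]] by (simp add: Re_cinner_self del: of_real_power)
qed

text \<open>A relation instead of a function, because the existence of an adjoint is derived from an
  orthonormal basis, which the type alone does not provide here.\<close>

definition is_adjoint :: "('a::complex_hilbert \<Rightarrow> 'a) \<Rightarrow> ('a \<Rightarrow> 'a) \<Rightarrow> bool" where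
  "is_adjoint T T' \<longleftrightarrow> bounded_clinear T \<and> bounded_clinear T' \<and> (\<forall>x y. T x \<bullet>\<^sub>C y = x \<bullet>\<^sub>C T' y)"

lemma is_adjointD: "is_adjoint T T' \<Longrightarrow> T x \<bullet>\<^sub>C y = x \<bullet>\<^sub>C T' y"
  by (simp add: is_adjoint_def)

lemma is_adjoint_sym:
  assumes "is_adjoint T T'"
  shows "is_adjoint T' T"
proof -
  have "T' x \<bullet>\<^sub>C y = x \<bullet>\<^sub>C T y" for x y
    using is_adjointD[OF assms, of y x] cinner_commute[of "T' x" y] cinner_commute[of x "T y"] by simp
  with assms show ?thesis by (simp add: is_adjoint_def)
qed

lemma is_adjoint_comp:
  "is_adjoint S S' \<Longrightarrow> is_adjoint T T' \<Longrightarrow> is_adjoint (S \<circ> T) (T' \<circ> S')"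
  by (simp add: is_adjoint_def bounded_clinear_comp)

lemma positive_op_is_adjoint: "positive_op T \<Longrightarrow> is_adjoint T T"
  by (simp add: is_adjoint_def positive_op_bounded positive_op_symmetric)

text \<open>T' y is built from its prescribed coefficients <T e, y>. A finite partial sum s of this
  series satisfies <T s, y> = |s|^2, hence |s| \<le> K |y|, and the coefficients are square
  summable.\<close>

lemma adjoint_exists:
  fixes T :: "'a::complex_hilbert \<Rightarrow> 'a" and E :: "'a set"
  assumes E: "is_onb E" and T: "bounded_clinear T"
  shows "\<exists>T'. is_adjoint T T'"
proof -
  obtain K where K: "K > 0" "\<And>x. norm (T x) \<le> K * norm x" using bounded_clinear_bound[OF T] by blast
  have bound: "(\<Sum>e\<in>F. (cmod (T e \<bullet>\<^sub>C y))\<^sup>2) \<le> (K * norm y)\<^sup>2" if F: "finite F" "F \<subseteq> E" for F y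
  proof -
    let ?s = "\<Sum>e\<in>F. (T e \<bullet>\<^sub>C y) *\<^sub>C e" and ?S = "\<Sum>e\<in>F. (cmod (T e \<bullet>\<^sub>C y))\<^sup>2"
    have norm_s: "(norm ?s)\<^sup>2 = ?S" by (rule norm_sq_sum_onb[OF E F])
    have "T ?s = (\<Sum>e\<in>F. (T e \<bullet>\<^sub>C y) *\<^sub>C T e)"
      by (simp add: linear_sum[OF bounded_linear.linear[OF bounded_clinear_linear[OF T]]]
          bounded_clinear_scaleC[OF T])
    then have "T ?s \<bullet>\<^sub>C y = complex_of_real ?S"
      by (simp add: cinner.sum_left cinner_scaleC_left complex_norm_square mult.commute
          del: of_real_power)
    then have "?S = Re (T ?s \<bullet>\<^sub>C y)" by simp
    also have "\<dots> \<le> norm (T ?s) * norm y" by (rule Re_cinner_le)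
    also have "\<dots> \<le> norm ?s * (K * norm y)"
      using mult_right_mono[OF K(2)[of ?s], of "norm y"] by (simp add: mult_ac)
    finally have "(norm ?s)\<^sup>2 \<le> norm ?s * (K * norm y)" unfolding norm_s .
    then have "norm ?s \<le> K * norm y"
      using K(1) by (cases "norm ?s = 0") (auto simp: mult_le_cancel_left power2_eq_square)
    then show ?thesis unfolding norm_s[symmetric] by (intro power_mono) auto
  qed
  have "\<exists>s. ((\<lambda>e. (T e \<bullet>\<^sub>C y) *\<^sub>C e) has_sum s) E" for y
    using summable_onb_coefficients(2)[OF E bound] by (simp add: summable_on_def)
  then obtain T' where T': "\<And>y. ((\<lambda>e. (T e \<bullet>\<^sub>C y) *\<^sub>C e) has_sum T' y) E" by metis
  have coeff: "e \<bullet>\<^sub>C T' y = T e \<bullet>\<^sub>C y" if "e \<in> E" for e y by (rule cinner_onb_sum[OF E T' that])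
  have adj: "T x \<bullet>\<^sub>C y = x \<bullet>\<^sub>C T' y" for x y
  proof (rule has_sum_unique)
    have "((\<lambda>e. T ((e \<bullet>\<^sub>C x) *\<^sub>C e)) has_sum T x) E"
      by (rule has_sum_bounded_linear[OF bounded_clinear_linear[OF T] onb_expansion[OF E]])
    from cinner_has_sum_left[OF this, of y]
    show "((\<lambda>e. cnj (e \<bullet>\<^sub>C x) * (T e \<bullet>\<^sub>C y)) has_sum T x \<bullet>\<^sub>C y) E"
      by (simp add: bounded_clinear_scaleC[OF T] cinner_scaleC_left)
    have "((\<lambda>e. (x \<bullet>\<^sub>C e) * (e \<bullet>\<^sub>C T' y)) has_sum x \<bullet>\<^sub>C T' y) E" by (rule parseval_cinner[OF E])
    moreover have "(x \<bullet>\<^sub>C e) * (e \<bullet>\<^sub>C T' y) = cnj (e \<bullet>\<^sub>C x) * (T e \<bullet>\<^sub>C y)" if "e \<in> E" for e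
      using cinner_commute[of x e] coeff[OF that] by simp
    ultimately show "((\<lambda>e. cnj (e \<bullet>\<^sub>C x) * (T e \<bullet>\<^sub>C y)) has_sum x \<bullet>\<^sub>C T' y) E"
      by (simp cong: has_sum_cong)
  qed
  have "bounded_clinear T'"
  proof (rule bounded_clinearI[where K = K])
    show "T' (x + y) = T' x + T' y" for x y
      by (rule cinner_eqI) (simp add: adj[symmetric] cinner.add_right)
    show "T' (c *\<^sub>C x) = c *\<^sub>C T' x" for c x
      by (rule cinner_eqI) (simp add: adj[symmetric] cinner_scaleC_right)
    show "norm (T' y) \<le> K * norm y" for y
    proof -
      have "(norm (T' y))\<^sup>2 = Re (T (T' y) \<bullet>\<^sub>C y)" by (simp add: adj Re_cinner_self)
      also have "\<dots> \<le> norm (T (T' y)) * norm y" by (rule Re_cinner_le)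
      also have "\<dots> \<le> norm (T' y) * (K * norm y)"
        using mult_right_mono[OF K(2)[of "T' y"], of "norm y"] by (simp add: mult_ac)
      finally show ?thesis
        using K(1) by (cases "norm (T' y) = 0") (auto simp: mult_le_cancel_left power2_eq_square)
    qed
  qed
  with T adj show ?thesis unfolding is_adjoint_def by blast
qed

section \<open>Hilbert--Schmidt operators\<close>

definition hilbert_schmidt :: "('a::complex_hilbert \<Rightarrow> 'a) \<Rightarrow> bool" where
  "hilbert_schmidt T \<longleftrightarrow> bounded_clinear T \<and> (\<exists>E. is_onb E \<and> (\<lambda>e. (norm (T e))\<^sup>2) summable_on E)"

lemma hilbert_schmidt_bounded: "hilbert_schmidt T \<Longrightarrow> bounded_clinear T"
  by (simp add: hilbert_schmidt_def)

lemma hilbert_schmidt_adjoint_exists: "hilbert_schmidt T \<Longrightarrow> \<exists>T'. is_adjoint T T'"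
  using adjoint_exists by (auto simp: hilbert_schmidt_def)

text \<open>The squared matrix entries |<f, T e>|^2 are summed by rows and by columns. Allowing two
  different bases is what yields independence of the basis.\<close>

lemma sum_norm_sq_adjoint:
  assumes adj: "is_adjoint T T'" and E: "is_onb E" and F: "is_onb F"
    and T: "(\<lambda>e. (norm (T e))\<^sup>2) summable_on E"
  shows "(\<lambda>f. (norm (T' f))\<^sup>2) summable_on F"
    "(\<Sum>\<^sub>\<infinity>f\<in>F. (norm (T' f))\<^sup>2) = (\<Sum>\<^sub>\<infinity>e\<in>E. (norm (T e))\<^sup>2)"
proof -
  let ?g = "\<lambda>e f. (cmod (f \<bullet>\<^sub>C T e))\<^sup>2"
  have row: "(?g e has_sum (norm (T e))\<^sup>2) F" for e by (rule parseval[OF F])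
  have "cmod (f \<bullet>\<^sub>C T e) = cmod (e \<bullet>\<^sub>C T' f)" for e f
    using is_adjointD[OF adj, of e f] cmod_cinner_commute[of f "T e"] by simp
  then have col: "((\<lambda>e. ?g e f) has_sum (norm (T' f))\<^sup>2) E" for f
    using parseval[OF E, of "T' f"] by simp
  have "(\<lambda>(e, f). ?g e f) summable_on E \<times> F"
    by (rule summable_on_Times_nonneg[OF row T]) simp
  from has_sum_exchange[OF this row col]
  show "(\<lambda>f. (norm (T' f))\<^sup>2) summable_on F"
    "(\<Sum>\<^sub>\<infinity>f\<in>F. (norm (T' f))\<^sup>2) = (\<Sum>\<^sub>\<infinity>e\<in>E. (norm (T e))\<^sup>2)" by simp_all
qed

text \<open>Two passages through the adjoint: from T on E to T' on F, and back to T on F.\<close>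

lemma hilbert_schmidt_summable:
  assumes T: "hilbert_schmidt T" and F: "is_onb F"
  shows "(\<lambda>f. (norm (T f))\<^sup>2) summable_on F"
proof -
  obtain E where E: "is_onb E" "(\<lambda>e. (norm (T e))\<^sup>2) summable_on E"
    using T by (auto simp: hilbert_schmidt_def)
  obtain T' where T': "is_adjoint T T'" using hilbert_schmidt_adjoint_exists[OF T] by blast
  show ?thesis
    using sum_norm_sq_adjoint(1)[OF is_adjoint_sym[OF T'] F F sum_norm_sq_adjoint(1)[OF T' E(1) F E(2)]] .
qed

lemma hilbert_schmidt_adjoint:
  assumes "hilbert_schmidt T" "is_adjoint T T'"
  shows "hilbert_schmidt T'"
proof -
  obtain E where "is_onb E" "(\<lambda>e. (norm (T e))\<^sup>2) summable_on E"
    using assms(1) by (auto simp: hilbert_schmidt_def)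
  then show ?thesis
    using sum_norm_sq_adjoint(1)[OF assms(2), of E E] assms(2)
    by (auto simp: hilbert_schmidt_def is_adjoint_def)
qed

lemma hilbert_schmidt_comp_left:
  assumes X: "bounded_clinear X" and T: "hilbert_schmidt T"
  shows "hilbert_schmidt (X \<circ> T)"
proof -
  obtain E where E: "is_onb E" "(\<lambda>e. (norm (T e))\<^sup>2) summable_on E"
    using T by (auto simp: hilbert_schmidt_def)
  obtain K where K: "K > 0" "\<And>x. norm (X x) \<le> K * norm x" using bounded_clinear_bound[OF X] by blast
  have "(norm (X (T e)))\<^sup>2 \<le> K\<^sup>2 * (norm (T e))\<^sup>2" for e
    using power_mono[OF K(2)[of "T e"] norm_ge_zero, of 2] by (simp add: power_mult_distrib)
  then have "(\<lambda>e. (norm (X (T e)))\<^sup>2) summable_on E"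
    by (intro summable_on_comparison_test[OF summable_on_cmult_right[OF E(2), of "K\<^sup>2"]]) auto
  then show ?thesis
    using E(1) bounded_clinear_comp[OF X hilbert_schmidt_bounded[OF T]]
    by (auto simp: hilbert_schmidt_def)
qed

text \<open>Take adjoints and use the left version for \<open>X' \<circ> T'\<close>.\<close>

lemma hilbert_schmidt_comp_right:
  fixes T :: "'a::complex_hilbert \<Rightarrow> 'a"
  assumes X: "bounded_clinear X" and T: "hilbert_schmidt T"
  shows "hilbert_schmidt (T \<circ> X)"
proof -
  obtain E :: "'a set" where E: "is_onb E" using T by (auto simp: hilbert_schmidt_def)
  obtain X' where X': "is_adjoint X X'" using adjoint_exists[OF E X] by blast
  obtain T' where T': "is_adjoint T T'" using hilbert_schmidt_adjoint_exists[OF T] by blast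
  have "hilbert_schmidt (X' \<circ> T')"
    using X' by (intro hilbert_schmidt_comp_left hilbert_schmidt_adjoint[OF T T'])
      (simp add: is_adjoint_def)
  from hilbert_schmidt_adjoint[OF this is_adjoint_sym[OF is_adjoint_comp[OF T' X']]] show ?thesis .
qed

lemma summable_on_half_add:
  "f summable_on A \<Longrightarrow> g summable_on A \<Longrightarrow> (\<lambda>x. (f x + g x) / (2::real)) summable_on A"
  using summable_on_cmult_left[OF summable_on_add, of f A g "1 / 2"] by simp

text \<open>The double series <e, G f> <f, H e> sums to one trace by rows and to the other by
  columns. Both matrices are square summable, so their product is jointly summable.\<close>

lemma trace_hilbert_schmidt:
  assumes G: "hilbert_schmidt G" and H: "hilbert_schmidt H" and E: "is_onb E"
  shows "(\<lambda>e. e \<bullet>\<^sub>C G (H e)) summable_on E"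
    "(\<Sum>\<^sub>\<infinity>e\<in>E. e \<bullet>\<^sub>C G (H e)) = (\<Sum>\<^sub>\<infinity>e\<in>E. e \<bullet>\<^sub>C H (G e))"
proof -
  obtain G' where G': "is_adjoint G G'" using hilbert_schmidt_adjoint_exists[OF G] by blast
  obtain H' where H': "is_adjoint H H'" using hilbert_schmidt_adjoint_exists[OF H] by blast
  note HSs = hilbert_schmidt_summable[OF _ E]
  let ?k = "\<lambda>e f. (e \<bullet>\<^sub>C G f) * (f \<bullet>\<^sub>C H e)"
  have row: "(?k e has_sum e \<bullet>\<^sub>C G (H e)) E" for e
    using parseval_cinner[OF E, of "G' e" "H e"] is_adjointD[OF is_adjoint_sym[OF G'], of e] by simp
  have col: "((\<lambda>e. ?k e f) has_sum f \<bullet>\<^sub>C H (G f)) E" for f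
    using parseval_cinner[OF E, of "H' f" "G f"] is_adjointD[OF is_adjoint_sym[OF H'], of f]
    by (simp add: mult.commute)
  have "(\<lambda>(e, f). (cmod (f \<bullet>\<^sub>C H e))\<^sup>2) summable_on E \<times> E"
    by (rule summable_on_Times_nonneg[OF parseval[OF E] HSs[OF H]]) simp
  moreover have "(\<lambda>(e, f). (cmod (e \<bullet>\<^sub>C G f))\<^sup>2) summable_on E \<times> E"
    by (rule summable_on_Times_swap, rule summable_on_Times_nonneg[OF parseval[OF E] HSs[OF G]]) simp
  ultimately have "(\<lambda>(e, f). ((cmod (e \<bullet>\<^sub>C G f))\<^sup>2 + (cmod (f \<bullet>\<^sub>C H e))\<^sup>2) / 2) summable_on E \<times> E"
    unfolding case_prod_unfold using summable_on_half_add by blast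
  then have "(\<lambda>(e, f). ?k e f) summable_on E \<times> E"
  proof (rule summable_on_Times_dominated)
    show "cmod (?k e f) \<le> ((cmod (e \<bullet>\<^sub>C G f))\<^sup>2 + (cmod (f \<bullet>\<^sub>C H e))\<^sup>2) / 2" for e f
      using sum_squares_bound[of "cmod (e \<bullet>\<^sub>C G f)" "cmod (f \<bullet>\<^sub>C H e)"] by (simp add: norm_mult)
  qed
  from has_sum_exchange[OF this row col]
  show "(\<lambda>e. e \<bullet>\<^sub>C G (H e)) summable_on E"
    "(\<Sum>\<^sub>\<infinity>e\<in>E. e \<bullet>\<^sub>C G (H e)) = (\<Sum>\<^sub>\<infinity>e\<in>E. e \<bullet>\<^sub>C H (G e))" by simp_all
qed

section \<open>Trace class operators\<close>

lemma trace_class_bounded: "trace_class T \<Longrightarrow> bounded_clinear T"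
  by (simp add: trace_class_def)

lemma trace_class_onb: "trace_class (T :: 'a::complex_hilbert \<Rightarrow> 'a) \<Longrightarrow> \<exists>E :: 'a set. is_onb E"
  by (auto simp: trace_class_def)

lemma positive_sqrt_hilbert_schmidt:
  assumes S: "positive_op S" and E: "is_onb E" and sm: "(\<lambda>e. e \<bullet>\<^sub>C S (S e)) summable_on E"
  shows "hilbert_schmidt S"
  using summable_on_Re[OF sm] E positive_op_bounded[OF S]
  by (auto simp: hilbert_schmidt_def positive_op_square[OF S])

text \<open>With T = U P and P = S S the factors are U S and S. Summability of <e, P e> = |S e|^2
  says precisely that S is Hilbert-Schmidt.\<close>

lemma trace_class_factor:
  assumes "trace_class T"
  obtains G H where "hilbert_schmidt G" "hilbert_schmidt H" "T = G \<circ> H"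
proof -
  obtain P E where P: "is_abs_op T P" and E: "is_onb E" and sm: "(\<lambda>e. e \<bullet>\<^sub>C P e) summable_on E"
    and T: "bounded_clinear T"
    using assms by (auto simp: trace_class_def)
  have pos: "positive_op P" using P by (simp add: is_abs_op_def)
  have "T x \<bullet>\<^sub>C T y = P x \<bullet>\<^sub>C P y" for x y
    using P positive_op_symmetric[OF pos] by (simp add: is_abs_op_def)
  from polar_decomposition[OF T pos this]
  obtain U where U: "bounded_clinear U" "T = U \<circ> P" by blast
  obtain S where S: "positive_op S" "S \<circ> S = P" using positive_sqrt_exists[OF pos] by blast
  have HS: "hilbert_schmidt S"
    using positive_sqrt_hilbert_schmidt[OF S(1) E] sm fun_cong[OF S(2)] by simp
  show ?thesis
    using that[OF hilbert_schmidt_comp_left[OF U(1) HS] HS] U(2) S(2) by (simp add: comp_assoc)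
qed

text \<open>The definition asks for the trace of Q = |M|, with M = G H. The second clause of the
  polar decomposition gives <e, Q e> = <U e, M e> = <G' U e, H e>, an inner product of two
  Hilbert-Schmidt columns.\<close>

lemma hilbert_schmidt_trace_class:
  fixes G :: "'a::complex_hilbert \<Rightarrow> 'a"
  assumes G: "hilbert_schmidt G" and H: "hilbert_schmidt H"
  shows "trace_class (G \<circ> H)"
proof -
  obtain E :: "'a set" where E: "is_onb E" using G by (auto simp: hilbert_schmidt_def)
  define M where "M = G \<circ> H"
  have bM: "bounded_clinear M"
    unfolding M_def by (intro bounded_clinear_comp hilbert_schmidt_bounded G H)
  obtain M' where M': "is_adjoint M M'" using adjoint_exists[OF E bM] by blast
  have "positive_op (M' \<circ> M)"
  proof (rule positive_opI)
    show "bounded_clinear (M' \<circ> M)" using M' by (simp add: is_adjoint_def bounded_clinear_comp)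
    show "(M' \<circ> M) x \<bullet>\<^sub>C y = x \<bullet>\<^sub>C (M' \<circ> M) y" for x y
      using is_adjointD[OF M'] is_adjointD[OF is_adjoint_sym[OF M']] by simp
    show "0 \<le> Re (x \<bullet>\<^sub>C (M' \<circ> M) x)" for x
      by (simp add: is_adjointD[OF M', symmetric] Re_cinner_self)
  qed
  then obtain Q where Q: "positive_op Q" "Q \<circ> Q = M' \<circ> M" using positive_sqrt_exists by blast
  have QM: "x \<bullet>\<^sub>C Q (Q y) = M x \<bullet>\<^sub>C M y" for x y
    using fun_cong[OF Q(2), of y] is_adjointD[OF M', of x "M y"] by simp
  then have "is_abs_op M Q" using Q(1) by (simp add: is_abs_op_def)
  moreover have "(\<lambda>e. e \<bullet>\<^sub>C Q e) summable_on E"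
  proof -
    obtain U where U: "bounded_clinear U" "\<And>x y. U x \<bullet>\<^sub>C M y = x \<bullet>\<^sub>C Q y"
      using polar_decomposition[OF bM Q(1)] QM positive_op_symmetric[OF Q(1)] by metis
    obtain G' where G': "is_adjoint G G'" using hilbert_schmidt_adjoint_exists[OF G] by blast
    have "hilbert_schmidt (G' \<circ> U)"
      by (rule hilbert_schmidt_comp_right[OF U(1) hilbert_schmidt_adjoint[OF G G']])
    from hilbert_schmidt_summable[OF this E] hilbert_schmidt_summable[OF H E]
    have "(\<lambda>e. ((norm ((G' \<circ> U) e))\<^sup>2 + (norm (H e))\<^sup>2) / 2) summable_on E"
      by (rule summable_on_half_add)
    moreover have "cmod (e \<bullet>\<^sub>C Q e) \<le> ((norm ((G' \<circ> U) e))\<^sup>2 + (norm (H e))\<^sup>2) / 2" for e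
      using norm_cinner_le_half_squares[of "G' (U e)" "H e"] U(2)[of e e]
        is_adjointD[OF is_adjoint_sym[OF G'], of "U e" "H e"] by (simp add: M_def)
    ultimately show ?thesis by (rule summable_on_dominated)
  qed
  ultimately have "trace_class M" using bM E unfolding trace_class_def by blast
  then show ?thesis by (simp add: M_def)
qed

lemma trace_class_comp_left:
  assumes X: "bounded_clinear X" and T: "trace_class T"
  shows "trace_class (X \<circ> T)"
proof -
  obtain G H where GH: "hilbert_schmidt G" "hilbert_schmidt H" "T = G \<circ> H"
    by (rule trace_class_factor[OF T])
  show ?thesis unfolding GH(3) comp_assoc[symmetric]
    by (rule hilbert_schmidt_trace_class[OF hilbert_schmidt_comp_left[OF X GH(1)] GH(2)])
qed

lemma trace_class_comp_right:
  assumes X: "bounded_clinear X" and T: "trace_class T"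
  shows "trace_class (T \<circ> X)"
proof -
  obtain G H where GH: "hilbert_schmidt G" "hilbert_schmidt H" "T = G \<circ> H"
    by (rule trace_class_factor[OF T])
  show ?thesis unfolding GH(3) comp_assoc
    by (rule hilbert_schmidt_trace_class[OF GH(1) hilbert_schmidt_comp_right[OF X GH(2)]])
qed

section \<open>The trace: cyclicity, linearity and rank-one operators\<close>

definition trace_basis :: "'a::complex_hilbert set" where
  "trace_basis = (SOME E. is_onb E)"

lemma is_onb_trace_basis: "\<exists>E :: 'a::complex_hilbert set. is_onb E \<Longrightarrow> is_onb (trace_basis :: 'a set)"
  unfolding trace_basis_def by (rule someI_ex)

lemma trace_op_alt: "trace_op T = (\<Sum>\<^sub>\<infinity>e\<in>trace_basis. e \<bullet>\<^sub>C T e)"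
  by (simp add: trace_op_def trace_basis_def)

lemma trace_op_has_sum:
  assumes T: "trace_class T"
  shows "((\<lambda>e. e \<bullet>\<^sub>C T e) has_sum trace_op T) trace_basis"
proof -
  obtain G H where "hilbert_schmidt G" "hilbert_schmidt H" "T = G \<circ> H"
    by (rule trace_class_factor[OF T])
  then show ?thesis
    using trace_hilbert_schmidt(1)[OF _ _ is_onb_trace_basis[OF trace_class_onb[OF T]]]
    by (simp add: trace_op_alt)
qed

lemma trace_op_hilbert_schmidt_commute:
  assumes "hilbert_schmidt G" "hilbert_schmidt H"
  shows "trace_op (G \<circ> H) = trace_op (H \<circ> G)"
  using trace_hilbert_schmidt(2)[OF assms is_onb_trace_basis[OF trace_class_onb[OF hilbert_schmidt_trace_class[OF assms]]]]
  by (simp add: trace_op_alt)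

text \<open>X need not be Hilbert-Schmidt, so X is absorbed into a factor and cyclicity is used
  twice: (X G) H to H (X G), then (H X) G to G (H X).\<close>

lemma trace_op_commute:
  assumes X: "bounded_clinear X" and T: "trace_class T"
  shows "trace_op (X \<circ> T) = trace_op (T \<circ> X)"
proof -
  obtain G H where GH: "hilbert_schmidt G" "hilbert_schmidt H" "T = G \<circ> H"
    by (rule trace_class_factor[OF T])
  have "trace_op (X \<circ> T) = trace_op ((X \<circ> G) \<circ> H)" by (simp add: GH(3) comp_assoc)
  also have "\<dots> = trace_op ((H \<circ> X) \<circ> G)"
    using trace_op_hilbert_schmidt_commute[OF hilbert_schmidt_comp_left[OF X GH(1)] GH(2)]
    by (simp add: comp_assoc)
  also have "\<dots> = trace_op (T \<circ> X)"
    using trace_op_hilbert_schmidt_commute[OF hilbert_schmidt_comp_right[OF X GH(2)] GH(1)]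
    by (simp add: GH(3) comp_assoc)
  finally show ?thesis .
qed

lemma trace_op_add:
  assumes "trace_class S" "trace_class T"
  shows "trace_op (\<lambda>x. S x + T x) = trace_op S + trace_op T"
  using has_sum_add[OF trace_op_has_sum[OF assms(1)] trace_op_has_sum[OF assms(2)]]
  unfolding trace_op_alt[of "\<lambda>x. S x + T x"] by (simp add: cinner.add_right[symmetric] infsumI)

lemma trace_op_scaleC:
  "trace_class T \<Longrightarrow> trace_op (\<lambda>x. c *\<^sub>C T x) = c * trace_op T"
  using has_sum_cmult_right[OF trace_op_has_sum[of T], of c]
  unfolding trace_op_alt[of "\<lambda>x. c *\<^sub>C T x"] by (simp add: cinner_scaleC_right infsumI)

text \<open>Dirac's |psi><phi|; traces against these recover matrix elements.\<close>

definition rank_one :: "'a::complex_hilbert \<Rightarrow> 'a \<Rightarrow> 'a \<Rightarrow> 'a" where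
  "rank_one \<psi> \<phi> = (\<lambda>v. (\<phi> \<bullet>\<^sub>C v) *\<^sub>C \<psi>)"

lemma bounded_clinear_rank_one: "bounded_clinear (rank_one \<psi> \<phi>)"
proof (rule bounded_clinearI[where K = "norm \<phi> * norm \<psi>"])
  show "norm (rank_one \<psi> \<phi> x) \<le> norm \<phi> * norm \<psi> * norm x" for x
    using mult_right_mono[OF norm_cinner_le[of \<phi> x], of "norm \<psi>"]
    by (simp add: rank_one_def norm_scaleC mult_ac)
qed (simp_all add: rank_one_def cinner.add_right scaleC_add_left cinner_scaleC_right scaleC_scaleC)

lemma hilbert_schmidt_rank_one:
  fixes \<psi> :: "'a::complex_hilbert"
  assumes E: "\<exists>E :: 'a set. is_onb E"
  shows "hilbert_schmidt (rank_one \<psi> \<phi>)"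
proof -
  obtain E :: "'a set" where E: "is_onb E" using E by blast
  have "(\<lambda>e. (cmod (e \<bullet>\<^sub>C \<phi>))\<^sup>2 * (norm \<psi>)\<^sup>2) summable_on E"
    using parseval[OF E, of \<phi>] by (intro summable_on_cmult_left) (auto simp: summable_on_def)
  moreover have "(norm (rank_one \<psi> \<phi> e))\<^sup>2 = (cmod (e \<bullet>\<^sub>C \<phi>))\<^sup>2 * (norm \<psi>)\<^sup>2" for e
    by (simp add: rank_one_def norm_scaleC power_mult_distrib cmod_cinner_commute[of \<phi> e])
  ultimately show ?thesis using E bounded_clinear_rank_one by (auto simp: hilbert_schmidt_def)
qed

lemma trace_class_rank_one:
  fixes \<psi> :: "'a::complex_hilbert"
  assumes E: "\<exists>E :: 'a set. is_onb E"
  shows "trace_class (rank_one \<psi> \<phi>)"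
proof -
  \<comment> \<open>Composing with |phi><phi| produces a factor |phi|^2, which the scaling cancels;
    for phi = 0 both sides vanish.\<close>
  have "rank_one \<psi> \<phi> = rank_one ((1 / (norm \<phi>)\<^sup>2) *\<^sub>R \<psi>) \<phi> \<circ> rank_one \<phi> \<phi>"
    by (cases "\<phi> = 0")
       (auto simp: rank_one_def fun_eq_iff cinner_scaleC_right cinner_self scaleR_eq_scaleC
          scaleC_scaleC cinner.zero_left scaleC.zero_left)
  then show ?thesis
    using hilbert_schmidt_trace_class[OF hilbert_schmidt_rank_one[OF E] hilbert_schmidt_rank_one[OF E]]
    by metis
qed

lemma trace_op_rank_one:
  fixes \<psi> :: "'a::complex_hilbert"
  assumes E: "\<exists>E :: 'a set. is_onb E" and X: "bounded_clinear X"
  shows "trace_op (X \<circ> rank_one \<psi> \<phi>) = \<phi> \<bullet>\<^sub>C X \<psi>"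
  using parseval_cinner[OF is_onb_trace_basis[OF E], of \<phi> "X \<psi>"]
  by (simp add: trace_op_alt rank_one_def bounded_clinear_scaleC[OF X] cinner_scaleC_right infsumI)

section \<open>Positive trace class operators and their sums\<close>

lemma positive_trace_class_sqrt:
  assumes R: "positive_op R" and T: "trace_class R"
  obtains Q where "positive_op Q" "R = Q \<circ> Q" "hilbert_schmidt Q"
    "((\<lambda>e. (norm (Q e))\<^sup>2) has_sum Re (trace_op R)) trace_basis"
proof -
  obtain Q where Q: "positive_op Q" "Q \<circ> Q = R" using positive_sqrt_exists[OF R] by blast
  have "e \<bullet>\<^sub>C R e = e \<bullet>\<^sub>C Q (Q e)" for e using Q(2) by auto
  then have s: "((\<lambda>e. e \<bullet>\<^sub>C Q (Q e)) has_sum trace_op R) trace_basis"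
    using trace_op_has_sum[OF T] by simp
  then have "hilbert_schmidt Q"
    by (intro positive_sqrt_hilbert_schmidt[OF Q(1) is_onb_trace_basis[OF trace_class_onb[OF T]]])
       (auto simp: summable_on_def)
  moreover have "((\<lambda>e. (norm (Q e))\<^sup>2) has_sum Re (trace_op R)) trace_basis"
    unfolding positive_op_square[OF Q(1)] by (rule has_sum_Re[OF s])
  ultimately show ?thesis using that Q by blast
qed

lemma positive_trace_classI:
  fixes R :: "'a::complex_hilbert \<Rightarrow> 'a"
  assumes R: "positive_op R" and E: "is_onb E" and s: "(\<lambda>e. e \<bullet>\<^sub>C R e) summable_on E"
  shows "trace_class R"
proof -
  obtain Q where Q: "positive_op Q" "Q \<circ> Q = R" using positive_sqrt_exists[OF R] by blast
  have "hilbert_schmidt Q"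
    using positive_sqrt_hilbert_schmidt[OF Q(1) E] s fun_cong[OF Q(2)] by simp
  from hilbert_schmidt_trace_class[OF this this] show ?thesis by (simp add: Q(2))
qed

text \<open>With R = Q Q, Parseval and Cauchy-Schwarz bound |Q v|^2 by the trace times |v|^2; this
  is applied to v and to Q v. It turns summable traces into pointwise absolute convergence of
  operator sums.\<close>

lemma positive_norm_le_trace:
  assumes R: "positive_op R" and T: "trace_class R"
  shows "norm (R v) \<le> Re (trace_op R) * norm v"
proof -
  obtain Q where Q: "positive_op Q" "R = Q \<circ> Q"
    "((\<lambda>e. (norm (Q e))\<^sup>2) has_sum Re (trace_op R)) trace_basis"
    using positive_trace_class_sqrt[OF R T] by metis
  let ?t = "Re (trace_op R)"
  have t: "?t \<ge> 0" by (rule has_sum_nonneg[OF Q(3)]) simp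
  have le: "(norm (Q v))\<^sup>2 \<le> ?t * (norm v)\<^sup>2" for v
  proof (rule has_sum_mono)
    show "((\<lambda>e. (cmod (e \<bullet>\<^sub>C Q v))\<^sup>2) has_sum (norm (Q v))\<^sup>2) trace_basis"
      by (rule parseval[OF is_onb_trace_basis[OF trace_class_onb[OF T]]])
    show "((\<lambda>e. (norm (Q e))\<^sup>2 * (norm v)\<^sup>2) has_sum ?t * (norm v)\<^sup>2) trace_basis"
      by (rule has_sum_cmult_left[OF Q(3)])
    show "(cmod (e \<bullet>\<^sub>C Q v))\<^sup>2 \<le> (norm (Q e))\<^sup>2 * (norm v)\<^sup>2" for e
      using power_mono[OF norm_cinner_le[of "Q e" v], of 2] positive_op_symmetric[OF Q(1), of e v]
      by (simp add: power_mult_distrib)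
  qed
  have "(norm (R v))\<^sup>2 \<le> ?t * (?t * (norm v)\<^sup>2)"
    using le[of "Q v"] mult_left_mono[OF le[of v] t] by (simp add: Q(2))
  also have "\<dots> = (?t * norm v)\<^sup>2" by (simp add: power2_eq_square)
  finally show ?thesis by (rule power2_le_imp_le) (use t in simp)
qed

lemma positive_op_infsum:
  fixes R :: "'i \<Rightarrow> 'a::complex_hilbert \<Rightarrow> 'a"
  assumes R: "\<And>x. x \<in> \<Omega> \<Longrightarrow> positive_op (R x)"
    and t: "t summable_on \<Omega>" and le: "\<And>x v. x \<in> \<Omega> \<Longrightarrow> norm (R x v) \<le> t x * norm v"
  shows "((\<lambda>x. R x v) has_sum (\<Sum>\<^sub>\<infinity>x\<in>\<Omega>. R x v)) \<Omega>" "positive_op (\<lambda>v. \<Sum>\<^sub>\<infinity>x\<in>\<Omega>. R x v)"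
proof -
  have bR: "bounded_clinear (R x)" if "x \<in> \<Omega>" for x using R[OF that] by (rule positive_op_bounded)
  have sm: "(\<lambda>x. R x v) summable_on \<Omega>" for v
    by (rule summable_on_dominated[OF summable_on_cmult_left[OF t] le])
  then show S: "((\<lambda>x. R x v) has_sum (\<Sum>\<^sub>\<infinity>x\<in>\<Omega>. R x v)) \<Omega>" for v by simp
  show "positive_op (\<lambda>v. \<Sum>\<^sub>\<infinity>x\<in>\<Omega>. R x v)"
  proof (rule positive_opI)
    show "bounded_clinear (\<lambda>v. \<Sum>\<^sub>\<infinity>x\<in>\<Omega>. R x v)"
    proof (rule bounded_clinearI[where K = "infsum t \<Omega>"])
      show "(\<Sum>\<^sub>\<infinity>x\<in>\<Omega>. R x (v + w)) = (\<Sum>\<^sub>\<infinity>x\<in>\<Omega>. R x v) + (\<Sum>\<^sub>\<infinity>x\<in>\<Omega>. R x w)" for v w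
        by (simp add: infsum_add[OF sm sm, symmetric] bounded_clinear_add[OF bR] cong: infsum_cong)
      show "(\<Sum>\<^sub>\<infinity>x\<in>\<Omega>. R x (c *\<^sub>C v)) = c *\<^sub>C (\<Sum>\<^sub>\<infinity>x\<in>\<Omega>. R x v)" for c v
        using infsumI[OF has_sum_bounded_linear[OF scaleC.bounded_linear_right S, of c v]]
        by (simp add: bounded_clinear_scaleC[OF bR] cong: infsum_cong)
      show "norm (\<Sum>\<^sub>\<infinity>x\<in>\<Omega>. R x v) \<le> infsum t \<Omega> * norm v" for v
        using norm_infsum_le[OF S has_sum_infsum[OF summable_on_cmult_left[OF t]] le]
        by (simp add: infsum_cmult_left t)
    qed
    show "(\<Sum>\<^sub>\<infinity>x\<in>\<Omega>. R x v) \<bullet>\<^sub>C w = v \<bullet>\<^sub>C (\<Sum>\<^sub>\<infinity>x\<in>\<Omega>. R x w)" for v w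
    proof (rule has_sum_unique)
      show "((\<lambda>x. R x v \<bullet>\<^sub>C w) has_sum (\<Sum>\<^sub>\<infinity>x\<in>\<Omega>. R x v) \<bullet>\<^sub>C w) \<Omega>"
        by (rule cinner_has_sum_left[OF S])
      show "((\<lambda>x. R x v \<bullet>\<^sub>C w) has_sum v \<bullet>\<^sub>C (\<Sum>\<^sub>\<infinity>x\<in>\<Omega>. R x w)) \<Omega>"
        using cinner_has_sum_right[OF S, of v w]
        by (simp add: positive_op_symmetric[OF R] cong: has_sum_cong)
    qed
    show "0 \<le> Re (v \<bullet>\<^sub>C (\<Sum>\<^sub>\<infinity>x\<in>\<Omega>. R x v))" for v
      by (rule has_sum_nonneg[OF has_sum_Re[OF cinner_has_sum_right[OF S]]])
         (simp add: positive_op_Re[OF R])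
  qed
qed

text \<open>Connects the pointwise sum in \<open>total_channel\<close> with traces. Writing R_x =
  Q_x Q_x, the entry <e, X R_x e> equals <Q_x X' e, Q_x e>, and both families are square summable
  over outcomes and basis together.\<close>

lemma trace_op_infsum_positive:
  fixes R :: "'i \<Rightarrow> 'a::complex_hilbert \<Rightarrow> 'a"
  assumes E: "\<exists>E :: 'a set. is_onb E"
    and R: "\<And>x. x \<in> \<Omega> \<Longrightarrow> positive_op (R x)" "\<And>x. x \<in> \<Omega> \<Longrightarrow> trace_class (R x)"
    and t: "(\<lambda>x. Re (trace_op (R x))) summable_on \<Omega>"
  defines "T \<equiv> \<lambda>v. \<Sum>\<^sub>\<infinity>x\<in>\<Omega>. R x v"
  shows "trace_class T"
    and "bounded_clinear X \<Longrightarrow> ((\<lambda>x. trace_op (X \<circ> R x)) has_sum trace_op (X \<circ> T)) \<Omega>"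
proof -
  note onb = is_onb_trace_basis[OF E]
  note sum = positive_op_infsum[OF R(1) t positive_norm_le_trace[OF R]]
  have T: "((\<lambda>x. R x v) has_sum T v) \<Omega>" for v unfolding T_def by (rule sum(1))
  have posT: "positive_op T" unfolding T_def by (rule sum(2))
  have "\<exists>Q. positive_op Q \<and> R x = Q \<circ> Q \<and>
      ((\<lambda>e. (norm (Q e))\<^sup>2) has_sum Re (trace_op (R x))) trace_basis" if "x \<in> \<Omega>" for x
    using positive_trace_class_sqrt[OF R(1,2)[OF that]] by metis
  then obtain Q where Q: "\<And>x. x \<in> \<Omega> \<Longrightarrow> positive_op (Q x)" "\<And>x. x \<in> \<Omega> \<Longrightarrow> R x = Q x \<circ> Q x"
      "\<And>x. x \<in> \<Omega> \<Longrightarrow> ((\<lambda>e. (norm (Q x e))\<^sup>2) has_sum Re (trace_op (R x))) trace_basis"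
    by metis
  have main: "(\<lambda>e. e \<bullet>\<^sub>C X (T e)) summable_on trace_basis"
    "((\<lambda>x. trace_op (X \<circ> R x)) has_sum trace_op (X \<circ> T)) \<Omega>" if X: "bounded_clinear X" for X
  proof -
    obtain X' where X': "is_adjoint X X'" using adjoint_exists[OF onb X] by blast
    obtain K where K: "K > 0" "\<And>x. norm (X x) \<le> K * norm x" using bounded_clinear_bound[OF X] by blast
    let ?f = "\<lambda>x e. e \<bullet>\<^sub>C X (R x e)"
    \<comment> \<open>The squared Hilbert-Schmidt norm of X Q_x. It is at most K^2 tr R_x and also
      belongs to the adjoint Q_x X', the operator that occurs in the domination.\<close>
    let ?r = "\<lambda>x. \<Sum>\<^sub>\<infinity>e\<in>trace_basis. (norm (X (Q x e)))\<^sup>2"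
    have XQ: "(norm (X (Q x e)))\<^sup>2 \<le> K\<^sup>2 * (norm (Q x e))\<^sup>2" for x e
      using power_mono[OF K(2)[of "Q x e"] norm_ge_zero, of 2] by (simp add: power_mult_distrib)
    have dom: "((\<lambda>e. K\<^sup>2 * (norm (Q x e))\<^sup>2) has_sum K\<^sup>2 * Re (trace_op (R x))) trace_basis"
      if "x \<in> \<Omega>" for x by (rule has_sum_cmult_right[OF Q(3)[OF that]])
    have smXQ: "(\<lambda>e. (norm (X (Q x e)))\<^sup>2) summable_on trace_basis" if "x \<in> \<Omega>" for x
      by (rule summable_on_comparison_test[OF has_sum_imp_summable[OF dom[OF that]]]) (simp_all add: XQ)
    have r_le: "?r x \<le> K\<^sup>2 * Re (trace_op (R x))" if "x \<in> \<Omega>" for x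
      by (rule has_sum_mono[OF has_sum_infsum[OF smXQ[OF that]] dom[OF that]]) (rule XQ)
    have r: "?r summable_on \<Omega>"
      by (rule summable_on_comparison_test[OF summable_on_cmult_right[OF t, of "K\<^sup>2"]])
         (auto simp: r_le intro!: infsum_nonneg)
    have rowX: "((\<lambda>e. (norm (Q x (X' e)))\<^sup>2) has_sum ?r x) trace_basis" if x: "x \<in> \<Omega>" for x
      using sum_norm_sq_adjoint[OF is_adjoint_comp[OF X' positive_op_is_adjoint[OF Q(1)[OF x]]] onb onb]
        smXQ[OF x] by (simp add: has_sum_iff)
    have "(\<lambda>(x, e). (norm (Q x (X' e)))\<^sup>2) summable_on \<Omega> \<times> trace_basis"
      by (rule summable_on_Times_nonneg[OF rowX r]) simp_all
    moreover have "(\<lambda>(x, e). (norm (Q x e))\<^sup>2) summable_on \<Omega> \<times> trace_basis"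
      by (rule summable_on_Times_nonneg[OF Q(3) t]) simp_all
    ultimately have "(\<lambda>(x, e). ((norm (Q x (X' e)))\<^sup>2 + (norm (Q x e))\<^sup>2) / 2) summable_on \<Omega> \<times> trace_basis"
      unfolding case_prod_unfold by (rule summable_on_half_add)
    then have f: "(\<lambda>(x, e). ?f x e) summable_on \<Omega> \<times> trace_basis"
    proof (rule summable_on_Times_dominated)
      fix x e assume x: "x \<in> \<Omega>"
      have "?f x e = Q x (X' e) \<bullet>\<^sub>C Q x e"
        using is_adjointD[OF is_adjoint_sym[OF X'], of e "R x e"]
        by (simp add: Q(2)[OF x] positive_op_symmetric[OF Q(1)[OF x]])
      then show "cmod (?f x e) \<le> ((norm (Q x (X' e)))\<^sup>2 + (norm (Q x e))\<^sup>2) / 2"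
        using norm_cinner_le_half_squares by simp
    qed
    have row: "(?f x has_sum trace_op (X \<circ> R x)) trace_basis" if "x \<in> \<Omega>" for x
      using trace_op_has_sum[OF trace_class_comp_left[OF X R(2)[OF that]]] by simp
    have col: "((\<lambda>x. ?f x e) has_sum e \<bullet>\<^sub>C X (T e)) \<Omega>" for e
      by (intro cinner_has_sum_right has_sum_bounded_linear[OF bounded_clinear_linear[OF X]] T)
    from has_sum_exchange[OF f row col]
    show "(\<lambda>e. e \<bullet>\<^sub>C X (T e)) summable_on trace_basis"
      "((\<lambda>x. trace_op (X \<circ> R x)) has_sum trace_op (X \<circ> T)) \<Omega>"
      by (auto simp: has_sum_iff trace_op_alt[of "X \<circ> T"])
  qed
  show "trace_class T"
    by (rule positive_trace_classI[OF posT onb]) (use main(1)[OF bounded_clinear_id] in simp)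
  show "bounded_clinear X \<Longrightarrow> ((\<lambda>x. trace_op (X \<circ> R x)) has_sum trace_op (X \<circ> T)) \<Omega>"
    by (rule main(2))
qed

section \<open>The \<open>\<sigma>\<close>-weak closure\<close>

text \<open>Otherwise disjoint neighbourhoods of the two values would pull back to generating open
  sets whose intersection contains X but no member of S.\<close>

lemma sigma_weak_closure_trace_eq:
  assumes X: "X \<in> sigma_weak_topology closure_of S"
    and T: "trace_class T" "trace_class T'"
    and eq: "\<And>Z. Z \<in> S \<Longrightarrow> trace_op (Z \<circ> T) = trace_op (Z \<circ> T')"
  shows "trace_op (X \<circ> T) = trace_op (X \<circ> T')"
proof (rule ccontr)
  let ?N = "\<lambda>T U. {X. bounded_clinear X \<and> trace_op (X \<circ> T) \<in> U}"
  assume "trace_op (X \<circ> T) \<noteq> trace_op (X \<circ> T')"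
  then obtain U V where UV: "open U" "open V" "trace_op (X \<circ> T) \<in> U" "trace_op (X \<circ> T') \<in> V" "U \<inter> V = {}"
    using hausdorff by metis
  have op: "openin sigma_weak_topology (?N T U)" if "trace_class T" "open U" for T U
    unfolding sigma_weak_topology_def by (rule topology_generated_by_Basis) (use that in blast)
  \<comment> \<open>The space is the union of the generating sets, and these contain bounded
    operators only.\<close>
  have "X \<in> topspace sigma_weak_topology" using X by (simp add: in_closure_of)
  then have "bounded_clinear X"
    unfolding sigma_weak_topology_def topology_generated_by_topspace by auto
  define W where "W = ?N T U \<inter> ?N T' V"
  have "X \<in> W" using UV(3,4) \<open>bounded_clinear X\<close> by (simp add: W_def)
  moreover have "openin sigma_weak_topology W"
    unfolding W_def by (rule openin_Int[OF op[OF T(1) UV(1)] op[OF T(2) UV(2)]])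
  ultimately obtain Z where "Z \<in> S" "Z \<in> W" using X by (auto simp: in_closure_of)
  with eq UV(5) show False by (auto simp: W_def)
qed

lemma trace_op_zero: "trace_op (\<lambda>_. 0) = 0"
  by (simp add: trace_op_def cinner.zero_right)

lemma trace_op_op_span_eq:
  assumes B: "\<And>y. y \<in> \<Omega> \<Longrightarrow> bounded_clinear (B y)"
    and T: "trace_class T" "trace_class T'"
    and eq: "\<And>y. y \<in> \<Omega> \<Longrightarrow> trace_op (B y \<circ> T) = trace_op (B y \<circ> T')"
    and Z: "Z \<in> op_span \<Omega> B"
  shows "trace_op (Z \<circ> T) = trace_op (Z \<circ> T')"
proof -
  obtain F c where F: "finite F" "F \<subseteq> \<Omega>" and Z: "Z = (\<lambda>\<psi>. \<Sum>y\<in>F. c y *\<^sub>C B y \<psi>)"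
    using Z by (auto simp: op_span_def)
  have "bounded_clinear (\<lambda>\<psi>. \<Sum>y\<in>F. c y *\<^sub>C B y \<psi>) \<and>
      trace_op ((\<lambda>\<psi>. \<Sum>y\<in>F. c y *\<^sub>C B y \<psi>) \<circ> T) = (\<Sum>y\<in>F. c y * trace_op (B y \<circ> T))"
    if "finite F" "F \<subseteq> \<Omega>" "trace_class T" for F T
    using that
  proof (induction F)
    case empty
    then show ?case by (simp add: o_def trace_op_zero bounded_clinear_zero_op)
  next
    case (insert y F)
    have By: "bounded_clinear (B y)" using insert.prems B by simp
    let ?Z = "\<lambda>\<psi>. \<Sum>y\<in>F. c y *\<^sub>C B y \<psi>" and ?Y = "\<lambda>\<psi>. c y *\<^sub>C B y \<psi>"
    have Z: "bounded_clinear ?Z" "trace_op (?Z \<circ> T) = (\<Sum>y\<in>F. c y * trace_op (B y \<circ> T))"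
      using insert.IH[OF _ insert.prems(2)] insert.prems(1) by blast+
    have Y: "bounded_clinear ?Y" by (rule bounded_clinear_times[OF By])
    have "trace_op ((\<lambda>\<psi>. \<Sum>y\<in>insert y F. c y *\<^sub>C B y \<psi>) \<circ> T) = trace_op (\<lambda>v. (?Y \<circ> T) v + (?Z \<circ> T) v)"
      using insert.hyps by (simp add: o_def)
    also have "\<dots> = trace_op (?Y \<circ> T) + trace_op (?Z \<circ> T)"
      using insert.prems by (intro trace_op_add trace_class_comp_left Y Z)
    also have "trace_op (?Y \<circ> T) = c y * trace_op (B y \<circ> T)"
      using trace_op_scaleC[OF trace_class_comp_left[OF By insert.prems(2)]] by (simp add: o_def)
    finally show ?case
      using insert.hyps Z(2) bounded_clinear_plus[OF Y Z(1)] by (simp add: o_def)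
  qed
  note this[OF F]
  then show ?thesis using T eq F(2) unfolding Z by (simp add: subset_iff cong: sum.cong)
qed

section \<open>Nondisturbing instruments\<close>

lemma observable_has_sum_cinner:
  assumes "observable \<Omega> A"
  shows "((\<lambda>x. \<phi> \<bullet>\<^sub>C A x \<psi>) has_sum \<phi> \<bullet>\<^sub>C \<psi>) \<Omega>"
  using assms by (auto simp: observable_def intro: cinner_has_sum_right)

lemma observable_positive: "observable \<Omega> A \<Longrightarrow> x \<in> \<Omega> \<Longrightarrow> positive_op (A x)"
  by (simp add: observable_def)

text \<open>The first-order condition for a minimum at t = 0.\<close>

lemma linear_coefficient_eq_0:
  fixes p a :: real
  assumes "a \<ge> 0" "\<And>t. 0 \<le> t * p + t\<^sup>2 * a"
  shows "p = 0"
proof -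
  \<comment> \<open>At t = -p / u the value is -(p / u)^2; adding 1 avoids division by zero and
    leaves u - a = 1.\<close>
  define u where "u = a + 1"
  have u: "u > 0" using assms(1) by (simp add: u_def)
  have "0 \<le> (- p / u) * p + (- p / u)\<^sup>2 * a" by (rule assms(2))
  also have "(- p / u) * p = - ((p / u)\<^sup>2 * u)" using u by (simp add: power2_eq_square)
  also have "- ((p / u)\<^sup>2 * u) + (- p / u)\<^sup>2 * a = - (p / u)\<^sup>2"
    by (simp add: u_def distrib_left)
  finally show ?thesis using u by simp
qed

section \<open>Channels on rank-one operators\<close>

lemma rank_one_add_left: "rank_one (\<psi> + \<psi>') \<phi> = (\<lambda>v. rank_one \<psi> \<phi> v + rank_one \<psi>' \<phi> v)"
  by (simp add: rank_one_def scaleC_add_right)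

lemma rank_one_add_right: "rank_one \<psi> (\<phi> + \<phi>') = (\<lambda>v. rank_one \<psi> \<phi> v + rank_one \<psi> \<phi>' v)"
  by (simp add: rank_one_def cinner.add_left scaleC_add_left)

lemma rank_one_scaleR_left: "rank_one (r *\<^sub>R \<psi>) \<phi> = (\<lambda>v. complex_of_real r *\<^sub>C rank_one \<psi> \<phi> v)"
  by (simp add: rank_one_def scaleR_eq_scaleC scaleC_scaleC mult.commute)

lemma rank_one_scaleR_right: "rank_one \<psi> (r *\<^sub>R \<phi>) = (\<lambda>v. complex_of_real r *\<^sub>C rank_one \<psi> \<phi> v)"
  by (simp add: rank_one_def cinner.scaleR_left scaleC_scaleC scaleR_conv_of_real)

lemma trace_op_channel_add:
  assumes J: "trace_class_linear J" and X: "bounded_clinear X" and T: "trace_class S" "trace_class T"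
  shows "trace_op (X \<circ> J (\<lambda>v. S v + T v)) = trace_op (X \<circ> J S) + trace_op (X \<circ> J T)"
proof -
  have JT: "trace_class (J S)" "trace_class (J T)" "J (\<lambda>v. S v + T v) = (\<lambda>v. J S v + J T v)"
    using J T by (auto simp: trace_class_linear_def)
  have "X \<circ> J (\<lambda>v. S v + T v) = (\<lambda>v. (X \<circ> J S) v + (X \<circ> J T) v)"
    by (simp add: JT(3) fun_eq_iff bounded_clinear_add[OF X])
  then show ?thesis
    using trace_op_add[OF trace_class_comp_left[OF X JT(1)] trace_class_comp_left[OF X JT(2)]] by simp
qed

lemma trace_op_channel_scaleC:
  assumes J: "trace_class_linear J" and X: "bounded_clinear X" and T: "trace_class T"
  shows "trace_op (X \<circ> J (\<lambda>v. c *\<^sub>C T v)) = c * trace_op (X \<circ> J T)"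
proof -
  have JT: "trace_class (J T)" "J (\<lambda>v. c *\<^sub>C T v) = (\<lambda>v. c *\<^sub>C J T v)"
    using J T by (auto simp: trace_class_linear_def)
  have "X \<circ> J (\<lambda>v. c *\<^sub>C T v) = (\<lambda>v. c *\<^sub>C (X \<circ> J T) v)"
    by (simp add: JT(2) fun_eq_iff bounded_clinear_scaleC[OF X])
  then show ?thesis using trace_op_scaleC[OF trace_class_comp_left[OF X JT(1)]] by simp
qed

text \<open>The real part of \<open>\<langle>\<eta>, J\<^sup>*(B) \<psi>\<rangle> + \<langle>\<psi>, J\<^sup>*(B) \<eta>\<rangle>\<close>.\<close>

definition cross_term ::
  "(('a::complex_hilbert \<Rightarrow> 'a) \<Rightarrow> 'a \<Rightarrow> 'a) \<Rightarrow> ('a \<Rightarrow> 'a) \<Rightarrow> 'a \<Rightarrow> 'a \<Rightarrow> real" where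
  "cross_term J B \<psi> \<eta> =
     Re (trace_op (B \<circ> J (rank_one \<psi> \<eta>)) + trace_op (B \<circ> J (rank_one \<eta> \<psi>)))"

context
  fixes J :: "('a::complex_hilbert \<Rightarrow> 'a) \<Rightarrow> 'a \<Rightarrow> 'a" and B :: "'a \<Rightarrow> 'a"
  assumes onb: "\<exists>E :: 'a set. is_onb E"
    and J: "trace_class_linear J" "completely_positive J"
    and B: "positive_op B"
begin

lemma trace_class_channel_rank_one: "trace_class (J (rank_one \<psi> \<phi>))"
  using J(1) trace_class_rank_one[OF onb] by (simp add: trace_class_linear_def)

lemma cross_term_commute: "cross_term J B \<psi> \<eta> = cross_term J B \<eta> \<psi>"
  by (simp add: cross_term_def)

lemma cross_term_add_right:
  "cross_term J B \<psi> (\<eta> + \<eta>') = cross_term J B \<psi> \<eta> + cross_term J B \<psi> \<eta>'"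
  by (simp add: cross_term_def rank_one_add_left rank_one_add_right
      trace_op_channel_add[OF J(1) positive_op_bounded[OF B] trace_class_rank_one[OF onb] trace_class_rank_one[OF onb]])

lemma cross_term_scaleR_right: "cross_term J B \<psi> (r *\<^sub>R \<eta>) = r * cross_term J B \<psi> \<eta>"
  by (simp add: cross_term_def rank_one_scaleR_left rank_one_scaleR_right
      trace_op_channel_scaleC[OF J(1) positive_op_bounded[OF B] trace_class_rank_one[OF onb]] distrib_left)

text \<open>Reduces off-diagonal inputs to diagonal ones. The images of the latter are positive, so
  the summation over outcomes for positive operators becomes available.\<close>

lemma cross_term_polarization:
  "cross_term J B \<psi> \<eta> = Re (trace_op (B \<circ> J (rank_one (\<psi> + \<eta>) (\<psi> + \<eta>))))
     - Re (trace_op (B \<circ> J (rank_one \<psi> \<psi>))) - Re (trace_op (B \<circ> J (rank_one \<eta> \<eta>)))"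
proof -
  have diag: "Re (trace_op (B \<circ> J (rank_one \<phi> \<phi>))) = cross_term J B \<phi> \<phi> / 2" for \<phi>
    by (simp add: cross_term_def)
  show ?thesis
    unfolding diag cross_term_add_right cross_term_commute[of "\<psi> + \<eta>"]
    using cross_term_commute[of \<psi> \<eta>] by (simp add: field_simps)
qed

lemma positive_channel_rank_one: "positive_op (J (rank_one \<psi> \<psi>))"
proof -
  have "positive_block 1 (\<lambda>i j. rank_one \<psi> \<psi>)"
    unfolding positive_block_def
  proof
    fix v :: "nat \<Rightarrow> 'a"
    have "v 0 \<bullet>\<^sub>C rank_one \<psi> \<psi> (v 0) = complex_of_real ((cmod (\<psi> \<bullet>\<^sub>C v 0))\<^sup>2)"
      using cinner_commute[of "v 0" \<psi>]
      by (simp add: rank_one_def cinner_scaleC_right complex_norm_square del: of_real_power)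
    then show "(\<Sum>i<1. \<Sum>j<1. v i \<bullet>\<^sub>C rank_one \<psi> \<psi> (v j)) \<in> \<real>\<^sub>\<ge>\<^sub>0" by simp
  qed
  then have "positive_block 1 (\<lambda>i j. J (rank_one \<psi> \<psi>))"
    using J(2)[unfolded completely_positive_def, rule_format, of 1 "\<lambda>i j. rank_one \<psi> \<psi>"] trace_class_rank_one[OF onb]
    by simp
  from this[unfolded positive_block_def, rule_format, of "\<lambda>_. v" for v] show ?thesis
    using trace_class_bounded[OF trace_class_channel_rank_one] by (simp add: positive_op_def)
qed

text \<open>
  With Kraus operators \<open>K\<close> of \<open>J\<close> the right-hand side is the sum of all \<open>\<parallel>B K \<psi> + K \<eta>\<parallel>\<^sup>2\<close>.
\<close>

lemma cross_term_nonneg: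
  "0 \<le> Re (trace_op ((B \<circ> B) \<circ> J (rank_one \<psi> \<psi>))) + cross_term J B \<psi> \<eta> + Re (trace_op (J (rank_one \<eta> \<eta>)))"
proof -
  define z where "z i = (if i = (0::nat) then \<psi> else \<eta>)" for i
  define R where "R i j = J (rank_one (z i) (z j))" for i j
  have tR: "trace_class (R i j)" for i j unfolding R_def by (rule trace_class_channel_rank_one)
  have "positive_block 2 (\<lambda>i j. rank_one (z i) (z j))"
    unfolding positive_block_def
  proof
    fix v :: "nat \<Rightarrow> 'a"
    have "(\<Sum>i<2. \<Sum>j<2. v i \<bullet>\<^sub>C rank_one (z i) (z j) (v j))
       = (\<Sum>j<2. z j \<bullet>\<^sub>C v j) * cnj (\<Sum>j<2. z j \<bullet>\<^sub>C v j)"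
      unfolding sum_distrib_right sum_distrib_left cnj_sum
      by (simp add: rank_one_def cinner_scaleC_right cinner_commute[of "v _" "z _"])
    also have "\<dots> \<in> \<real>\<^sub>\<ge>\<^sub>0"
      unfolding complex_norm_square[symmetric] by (simp del: of_real_power)
    finally show "(\<Sum>i<2. \<Sum>j<2. v i \<bullet>\<^sub>C rank_one (z i) (z j) (v j)) \<in> \<real>\<^sub>\<ge>\<^sub>0" .
  qed
  then have pb: "positive_block 2 R"
    using J(2)[unfolded completely_positive_def, rule_format, of 2 "\<lambda>i j. rank_one (z i) (z j)"]
      trace_class_rank_one[OF onb] by (simp add: R_def[abs_def])
  \<comment> \<open>The block is tested on the vector (B e, e). Summed over the basis this gives
    traces, and cyclicity collects both outer factors B into B^2.\<close>
  have nonneg: "0 \<le> Re (e \<bullet>\<^sub>C (B \<circ> (R 0 0 \<circ> B)) e + e \<bullet>\<^sub>C (B \<circ> R 0 1) e + (e \<bullet>\<^sub>C (R 1 0 \<circ> B) e + e \<bullet>\<^sub>C R 1 1 e))" for e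
    using pb[unfolded positive_block_def, rule_format, of "\<lambda>i. if i = 0 then B e else e"]
    by (simp add: numeral_2_eq_2 complex_nonneg_Reals_iff positive_op_symmetric[OF B] add.assoc)
  have "((\<lambda>e. e \<bullet>\<^sub>C (B \<circ> (R 0 0 \<circ> B)) e + e \<bullet>\<^sub>C (B \<circ> R 0 1) e + (e \<bullet>\<^sub>C (R 1 0 \<circ> B) e + e \<bullet>\<^sub>C R 1 1 e))
      has_sum trace_op (B \<circ> (R 0 0 \<circ> B)) + trace_op (B \<circ> R 0 1) + (trace_op (R 1 0 \<circ> B) + trace_op (R 1 1)))
      trace_basis"
    by (intro has_sum_add trace_op_has_sum trace_class_comp_left trace_class_comp_right tR positive_op_bounded[OF B])
  from has_sum_nonneg[OF has_sum_Re[OF this] nonneg]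
  have "0 \<le> Re (trace_op (B \<circ> (R 0 0 \<circ> B)) + trace_op (B \<circ> R 0 1) + (trace_op (R 1 0 \<circ> B) + trace_op (R 1 1)))" .
  moreover have "trace_op (B \<circ> (R 0 0 \<circ> B)) = trace_op ((B \<circ> B) \<circ> R 0 0)"
    using trace_op_commute[OF positive_op_bounded[OF B] trace_class_comp_right[OF positive_op_bounded[OF B] tR]]
      trace_op_commute[OF bounded_clinear_comp[OF positive_op_bounded[OF B] positive_op_bounded[OF B]] tR] by (simp add: comp_assoc)
  moreover have "trace_op (R 1 0 \<circ> B) = trace_op (B \<circ> R 1 0)"
    by (rule trace_op_commute[OF positive_op_bounded[OF B] tR, symmetric])
  ultimately show ?thesis by (simp add: cross_term_def R_def z_def)
qed

end

lemma dual_value_rank_one: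
  fixes X :: "'a::complex_hilbert \<Rightarrow> 'a"
  assumes E: "\<exists>E :: 'a set. is_onb E" and "dual_value \<Phi> X Z"
  shows "trace_op (X \<circ> \<Phi> (rank_one \<psi> \<phi>)) = \<phi> \<bullet>\<^sub>C Z \<psi>"
  using assms trace_class_rank_one[OF E] trace_op_rank_one[OF E]
  by (simp add: dual_value_def)

lemma nondisturbing_imp_commute:
  fixes A :: "'i \<Rightarrow> 'a::complex_hilbert \<Rightarrow> 'a" and B :: "'j \<Rightarrow> 'a \<Rightarrow> 'a"
  assumes onb: "\<exists>E :: 'a set. is_onb E" and B: "observable \<Omega>\<^sub>B B"
    and B_square: "\<And>y. y \<in> \<Omega>\<^sub>B \<Longrightarrow> B y \<circ> B y \<in> sigma_weak_topology closure_of op_span \<Omega>\<^sub>B B"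
    and A: "observable \<Omega>\<^sub>A A" and impl: "implements \<Omega>\<^sub>A I A"
    and nd: "\<And>y. y \<in> \<Omega>\<^sub>B \<Longrightarrow> dual_value (total_channel \<Omega>\<^sub>A I) (B y) (B y)"
    and x: "x \<in> \<Omega>\<^sub>A" and y: "y \<in> \<Omega>\<^sub>B"
  shows "A x (B y \<psi>) = B y (A x \<psi>)"
proof -
  have I: "trace_class_linear (I x)" "completely_positive (I x)" "dual_value (I x) id (A x)"
    if "x \<in> \<Omega>\<^sub>A" for x using impl that by (auto simp: implements_def)
  let ?B = "B y"
  note By = observable_positive[OF B y]
  note bB = positive_op_bounded[OF By]
  let ?R = "\<lambda>\<psi> x. I x (rank_one \<psi> \<psi>)" and ?T = "\<lambda>\<psi>. total_channel \<Omega>\<^sub>A I (rank_one \<psi> \<psi>)"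
  note pos = positive_channel_rank_one[OF onb I(1,2)]
  note tc = trace_class_channel_rank_one[OF onb I(1,2)]
  have tr: "trace_op (?R \<psi> x) = \<psi> \<bullet>\<^sub>C A x \<psi>" if "x \<in> \<Omega>\<^sub>A" for x \<psi>
    using dual_value_rank_one[OF onb I(3)[OF that]] by simp
  have tr_sum: "((\<lambda>x. trace_op (?R \<psi> x)) has_sum \<psi> \<bullet>\<^sub>C \<psi>) \<Omega>\<^sub>A" for \<psi>
    using observable_has_sum_cinner[OF A, of \<psi> \<psi>] tr by (simp cong: has_sum_cong)
  have smble: "(\<lambda>x. Re (trace_op (?R \<psi> x))) summable_on \<Omega>\<^sub>A" for \<psi>
    using has_sum_Re[OF tr_sum] by (auto simp: summable_on_def)
  have sum: "trace_class (?T \<psi>)"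
    "bounded_clinear X \<Longrightarrow> ((\<lambda>x. trace_op (X \<circ> ?R \<psi> x)) has_sum trace_op (X \<circ> ?T \<psi>)) \<Omega>\<^sub>A" for X \<psi>
    using trace_op_infsum_positive[OF onb pos[OF _ _ By] tc[OF _ _ By] smble]
    unfolding total_channel_def by blast+
  have dualB: "trace_op (B y \<circ> ?T \<psi>) = \<psi> \<bullet>\<^sub>C B y \<psi>" if "y \<in> \<Omega>\<^sub>B" for y \<psi>
    by (rule dual_value_rank_one[OF onb nd[OF that]])
  have dualBB: "trace_op ((?B \<circ> ?B) \<circ> ?T \<psi>) = \<psi> \<bullet>\<^sub>C ?B (?B \<psi>)" for \<psi>
  proof -
    \<comment> \<open>The output of the channel and its input define the same functional on each
      B_y, hence on the span and on its closure.\<close>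
    have "trace_op ((?B \<circ> ?B) \<circ> ?T \<psi>) = trace_op ((?B \<circ> ?B) \<circ> rank_one \<psi> \<psi>)"
    proof (rule sigma_weak_closure_trace_eq[OF B_square[OF y] sum(1) trace_class_rank_one[OF onb]])
      fix Z assume "Z \<in> op_span \<Omega>\<^sub>B B"
      then show "trace_op (Z \<circ> ?T \<psi>) = trace_op (Z \<circ> rank_one \<psi> \<psi>)"
        by (rule trace_op_op_span_eq[OF _ sum(1) trace_class_rank_one[OF onb], rotated 2])
           (simp_all add: positive_op_bounded[OF observable_positive[OF B]] dualB trace_op_rank_one[OF onb])
    qed
    then show ?thesis using trace_op_rank_one[OF onb bounded_clinear_comp[OF bB bB]] by simp
  qed
  let ?s = "\<lambda>x. cross_term (I x) ?B"
  let ?q = "\<lambda>x \<psi> \<eta>. Re (trace_op ((?B \<circ> ?B) \<circ> ?R \<psi> x)) + ?s x \<psi> \<eta> + Re (trace_op (?R \<eta> x))"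
  have q_nonneg: "0 \<le> ?q x \<psi> \<eta>" if "x \<in> \<Omega>\<^sub>A" for x \<psi> \<eta>
    by (rule cross_term_nonneg[OF onb I(1,2)[OF that] By])
  have s_sum: "((\<lambda>x. ?s x \<psi> \<eta>) has_sum 2 * Re (\<eta> \<bullet>\<^sub>C ?B \<psi>)) \<Omega>\<^sub>A" for \<psi> \<eta>
  proof -
    let ?b = "\<lambda>x \<phi>. Re (trace_op (?B \<circ> ?R \<phi> x))"
    have b: "((\<lambda>x. ?b x \<phi>) has_sum Re (\<phi> \<bullet>\<^sub>C ?B \<phi>)) \<Omega>\<^sub>A" for \<phi>
      using has_sum_Re[OF sum(2)[OF bB, of \<phi>]] dualB[OF y] by simp
    have "((\<lambda>x. ?b x (\<psi> + \<eta>) + (- ?b x \<psi> + - ?b x \<eta>)) has_sum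
        Re ((\<psi> + \<eta>) \<bullet>\<^sub>C ?B (\<psi> + \<eta>)) + (- Re (\<psi> \<bullet>\<^sub>C ?B \<psi>) + - Re (\<eta> \<bullet>\<^sub>C ?B \<eta>))) \<Omega>\<^sub>A"
      by (intro has_sum_add has_sum_uminusI b)
    moreover have s_b: "?s x \<psi> \<eta> = ?b x (\<psi> + \<eta>) + (- ?b x \<psi> + - ?b x \<eta>)" if "x \<in> \<Omega>\<^sub>A" for x
      unfolding cross_term_polarization[OF onb I(1,2)[OF that] By] by simp
    moreover have val: "Re ((\<psi> + \<eta>) \<bullet>\<^sub>C ?B (\<psi> + \<eta>)) + (- Re (\<psi> \<bullet>\<^sub>C ?B \<psi>) + - Re (\<eta> \<bullet>\<^sub>C ?B \<eta>))
        = 2 * Re (\<eta> \<bullet>\<^sub>C ?B \<psi>)"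
      using positive_op_symmetric[OF By, of \<psi> \<eta>] Re_cinner_commute[of "?B \<psi>" \<eta>]
      by (simp add: bounded_clinear_add[OF bB] cinner.add_left cinner.add_right)
    ultimately show ?thesis by (simp only: has_sum_cong[OF s_b] val)
  qed
  have "((\<lambda>x. ?q x \<psi> (- ?B \<psi>)) has_sum
      Re (\<psi> \<bullet>\<^sub>C ?B (?B \<psi>)) + 2 * Re ((- ?B \<psi>) \<bullet>\<^sub>C ?B \<psi>) + Re ((- ?B \<psi>) \<bullet>\<^sub>C (- ?B \<psi>))) \<Omega>\<^sub>A" for \<psi>
    using sum(2)[OF bounded_clinear_comp[OF bB bB], of \<psi>] unfolding dualBB
    by (intro has_sum_add has_sum_Re s_sum tr_sum)
  \<comment> \<open>The three terms are |B psi|^2, -2 |B psi|^2 and |B psi|^2.\<close>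
  moreover have "Re (\<psi> \<bullet>\<^sub>C ?B (?B \<psi>)) + 2 * Re ((- ?B \<psi>) \<bullet>\<^sub>C ?B \<psi>) + Re ((- ?B \<psi>) \<bullet>\<^sub>C (- ?B \<psi>)) = 0" for \<psi>
    using positive_op_symmetric[OF By, of \<psi> "?B \<psi>"] by (simp add: cinner.minus_left cinner.minus_right)
  ultimately have q_sum: "((\<lambda>x. ?q x \<psi> (- ?B \<psi>)) has_sum 0) \<Omega>\<^sub>A" for \<psi> by simp
  have q_zero: "?q x \<psi> (- ?B \<psi>) = 0" for \<psi>
    by (rule nonneg_has_sum_le_0D[OF q_sum _ q_nonneg x]) simp
  note Ax = observable_positive[OF A x]
  note bA = positive_op_bounded[OF Ax]
  have s_eq: "?s x \<psi> \<eta> = 2 * Re (\<eta> \<bullet>\<^sub>C A x (?B \<psi>))" for \<psi> \<eta>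
  proof -
    have "?s x \<psi> \<eta> - 2 * Re (\<eta> \<bullet>\<^sub>C A x (?B \<psi>)) = 0"
    proof (rule linear_coefficient_eq_0)
      show "Re (\<eta> \<bullet>\<^sub>C A x \<eta>) \<ge> 0" by (rule positive_op_Re[OF Ax])
      fix t :: real
      \<comment> \<open>Perturb the zero of the nonnegative quadratic along eta; the linear
        coefficient in t must vanish.\<close>
      let ?w = "- ?B \<psi> + t *\<^sub>R \<eta>"
      have "Re (?w \<bullet>\<^sub>C A x ?w) = Re ((- ?B \<psi>) \<bullet>\<^sub>C A x (- ?B \<psi>))
          - 2 * t * Re (\<eta> \<bullet>\<^sub>C A x (?B \<psi>)) + t\<^sup>2 * Re (\<eta> \<bullet>\<^sub>C A x \<eta>)"
        using positive_op_symmetric[OF Ax, of "?B \<psi>" \<eta>] Re_cinner_commute[of "A x (?B \<psi>)" \<eta>]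
        by (simp add: bounded_clinear_add[OF bA] bounded_clinear_scaleR[OF bA]
            linear_simps[OF bounded_clinear_linear[OF bA]] cinner.add_left cinner.add_right
            cinner.minus_left cinner.minus_right cinner.scaleR_left cinner.scaleR_right
            cinner.diff_left cinner.diff_right
            power2_eq_square algebra_simps)
      then have "?q x \<psi> ?w = ?q x \<psi> (- ?B \<psi>)
          + (t * (?s x \<psi> \<eta> - 2 * Re (\<eta> \<bullet>\<^sub>C A x (?B \<psi>))) + t\<^sup>2 * Re (\<eta> \<bullet>\<^sub>C A x \<eta>))"
        unfolding tr[OF x] cross_term_add_right[OF onb I(1,2)[OF x] By]
          cross_term_scaleR_right[OF onb I(1,2)[OF x] By] by (simp add: algebra_simps)
      with q_nonneg[OF x, of \<psi> ?w] q_zero[of \<psi>]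
      show "0 \<le> t * (?s x \<psi> \<eta> - 2 * Re (\<eta> \<bullet>\<^sub>C A x (?B \<psi>))) + t\<^sup>2 * Re (\<eta> \<bullet>\<^sub>C A x \<eta>)" by linarith
    qed
    then show ?thesis by simp
  qed
  \<comment> \<open>The cross term is symmetric in psi and eta, which expresses here that the
    adjoint of I_x takes B_y to a selfadjoint operator.\<close>
  have eq: "Re (\<eta> \<bullet>\<^sub>C A x (?B \<psi>)) = Re (\<eta> \<bullet>\<^sub>C ?B (A x \<psi>))" for \<eta>
  proof -
    have "Re (\<eta> \<bullet>\<^sub>C A x (?B \<psi>)) = Re (\<psi> \<bullet>\<^sub>C A x (?B \<eta>))"
      using s_eq[of \<psi> \<eta>] s_eq[of \<eta> \<psi>] by (simp add: cross_term_def)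
    also have "\<psi> \<bullet>\<^sub>C A x (?B \<eta>) = ?B (A x \<psi>) \<bullet>\<^sub>C \<eta>"
      by (simp add: positive_op_symmetric[OF By] positive_op_symmetric[OF Ax])
    finally show ?thesis by (simp add: Re_cinner_commute[of _ \<eta>])
  qed
  \<comment> \<open>Knowing real parts suffices: taking eta to be the commutator applied to psi
    turns the real part into a squared norm.\<close>
  have "(norm (A x (?B \<psi>) - ?B (A x \<psi>)))\<^sup>2 = 0"
    using eq[of "A x (?B \<psi>) - ?B (A x \<psi>)"] by (simp add: Re_cinner_self[symmetric] cinner.diff_right)
  then show ?thesis by simp
qed

section \<open>The Lueders instrument\<close>

context
  fixes \<Omega> :: "'i set" and A S :: "'i \<Rightarrow> 'a::complex_hilbert \<Rightarrow> 'a"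
  assumes A: "observable \<Omega> A"
    and S: "\<And>x. x \<in> \<Omega> \<Longrightarrow> positive_op (S x)" "\<And>x. x \<in> \<Omega> \<Longrightarrow> S x \<circ> S x = A x"
begin

text \<open>The map v -> (S_x v) is an isometry into the direct sum over outcomes; this is the form
  in which the normalization of A enters the estimates below.\<close>

lemma sqrt_observable_has_sum: "((\<lambda>x. (norm (S x v))\<^sup>2) has_sum (norm v)\<^sup>2) \<Omega>"
proof -
  have "(norm (S x v))\<^sup>2 = Re (v \<bullet>\<^sub>C A x v)" if "x \<in> \<Omega>" for x
    using positive_op_square[OF S(1)[OF that], of v] S(2)[OF that, symmetric] by simp
  then show ?thesis
    using has_sum_Re[OF observable_has_sum_cinner[OF A, of v v], unfolded Re_cinner_self]
    by (simp cong: has_sum_cong)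
qed

text \<open>The norms need not be summable for bounded Y (take Y = 1 and rank-one projections).
  Pairing a partial sum w with itself moves one S_x onto w, and Cauchy-Schwarz over outcomes with
  the isometry gives |w|^2 \<le> K^2 times the partial sum of |S_x v|^2.\<close>

lemma luders_summable:
  assumes Y: "bounded_clinear Y"
  shows "(\<lambda>x. S x (Y (S x v))) summable_on \<Omega>"
proof -
  obtain K where K: "K > 0" "\<And>x. norm (Y x) \<le> K * norm x" using bounded_clinear_bound[OF Y] by blast
  show ?thesis
  proof (rule summable_on_norm_sq_dominated[where C = "K\<^sup>2"])
    show "(\<lambda>x. (norm (S x v))\<^sup>2) summable_on \<Omega>"
      using sqrt_observable_has_sum by (rule has_sum_imp_summable)
    fix F assume F: "finite F" "F \<subseteq> \<Omega>"
    let ?w = "\<Sum>x\<in>F. S x (Y (S x v))" and ?b = "\<Sum>x\<in>F. (norm (S x v))\<^sup>2"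
    have "(norm ?w)\<^sup>2 = Re (?w \<bullet>\<^sub>C ?w)" by (simp add: Re_cinner_self)
    also have "\<dots> = (\<Sum>x\<in>F. Re (?w \<bullet>\<^sub>C S x (Y (S x v))))"
      by (simp add: cinner.sum_right[of "?w"] Re_sum)
    also have "\<dots> \<le> (\<Sum>x\<in>F. norm (S x ?w) * (K * norm (S x v)))"
    proof (rule sum_mono)
      fix x assume "x \<in> F"
      then have "?w \<bullet>\<^sub>C S x (Y (S x v)) = S x ?w \<bullet>\<^sub>C Y (S x v)"
        using positive_op_symmetric[OF S(1)] F(2) by auto
      also have "Re \<dots> \<le> norm (S x ?w) * norm (Y (S x v))" by (rule Re_cinner_le)
      also have "\<dots> \<le> norm (S x ?w) * (K * norm (S x v))" by (intro mult_left_mono K) simp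
      finally show "Re (?w \<bullet>\<^sub>C S x (Y (S x v))) \<le> norm (S x ?w) * (K * norm (S x v))" .
    qed
    finally have "((norm ?w)\<^sup>2)\<^sup>2 \<le> (\<Sum>x\<in>F. norm (S x ?w) * (K * norm (S x v)))\<^sup>2"
      by (intro power_mono) simp_all
    also have "\<dots> \<le> (\<Sum>x\<in>F. (norm (S x ?w))\<^sup>2) * (\<Sum>x\<in>F. (K * norm (S x v))\<^sup>2)"
      by (rule Cauchy_Schwarz_ineq_sum)
    also have "\<dots> \<le> (norm ?w)\<^sup>2 * (\<Sum>x\<in>F. (K * norm (S x v))\<^sup>2)"
      using finite_sum_le_has_sum[OF sqrt_observable_has_sum[of ?w] F]
      by (intro mult_right_mono sum_nonneg) auto
    also have "(\<Sum>x\<in>F. (K * norm (S x v))\<^sup>2) = K\<^sup>2 * ?b"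
      by (simp add: power_mult_distrib sum_distrib_left)
    finally have "(norm ?w)\<^sup>2 * (norm ?w)\<^sup>2 \<le> (norm ?w)\<^sup>2 * (K\<^sup>2 * ?b)"
      unfolding power2_eq_square[of "(norm ?w)\<^sup>2"] .
    moreover have "0 \<le> K\<^sup>2 * ?b" by (intro mult_nonneg_nonneg sum_nonneg) auto
    \<comment> \<open>Cancels the common factor |w|^2, which may be zero.\<close>
    moreover have "a \<le> c" if "a * a \<le> a * c" "0 \<le> c" "0 \<le> a" for a c :: real
      using that by (cases "a = 0") (auto simp: mult_le_cancel_left)
    ultimately show "(norm ?w)\<^sup>2 \<le> K\<^sup>2 * ?b" by simp
  qed simp
qed

lemma luders_summable_column:
  assumes L: "hilbert_schmidt L" and E: "is_onb E"
  shows "(\<lambda>(x, e). (norm (S x (L e)))\<^sup>2) summable_on \<Omega> \<times> E"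
  by (rule summable_on_Times_swap,
      rule summable_on_Times_nonneg[OF sqrt_observable_has_sum hilbert_schmidt_summable[OF L E]]) simp

text \<open>The adjoint of L S_x is S_x L', so summing squares over the basis reduces this to the
  column case.\<close>

lemma luders_summable_row:
  assumes L: "hilbert_schmidt L" and E: "is_onb E"
  shows "(\<lambda>(x, e). (norm (L (S x e)))\<^sup>2) summable_on \<Omega> \<times> E"
proof -
  obtain L' where L': "is_adjoint L L'" using hilbert_schmidt_adjoint_exists[OF L] by blast
  note HL' = hilbert_schmidt_adjoint[OF L L']
  let ?r = "\<lambda>x. \<Sum>\<^sub>\<infinity>e\<in>E. (norm (S x (L' e)))\<^sup>2"
  have sm: "(\<lambda>e. (norm (S x (L' e)))\<^sup>2) summable_on E" if "x \<in> \<Omega>" for x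
    using hilbert_schmidt_summable[OF hilbert_schmidt_comp_left[OF positive_op_bounded[OF S(1)[OF that]] HL'] E]
    by simp
  have r: "?r summable_on \<Omega>"
    by (rule has_sum_exchange(1)[OF luders_summable_column[OF HL' E] has_sum_infsum[OF sm]
          sqrt_observable_has_sum])
  have "((\<lambda>e. (norm (L (S x e)))\<^sup>2) has_sum ?r x) E" if "x \<in> \<Omega>" for x
    using sum_norm_sq_adjoint[OF is_adjoint_comp[OF positive_op_is_adjoint[OF S(1)[OF that]] is_adjoint_sym[OF L']] E E]
      sm[OF that] by (simp add: has_sum_iff)
  from summable_on_Times_nonneg[OF this r] show ?thesis by simp
qed

text \<open>Y need not be positive, so the exchange is done with its factors G and H. One exchange
  pulls the outcome sum out of the trace; a second, after cyclic rearrangement, brings the two S_x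
  together, where they form A_x and sum to the identity.\<close>

lemma luders_trace:
  assumes B: "positive_op B" and comm: "\<And>x v. x \<in> \<Omega> \<Longrightarrow> B (S x v) = S x (B v)"
    and Y: "trace_class Y"
  shows "trace_op (B \<circ> total_channel \<Omega> (\<lambda>x Y. S x \<circ> Y \<circ> S x) Y) = trace_op (B \<circ> Y)"
proof -
  note bB = positive_op_bounded[OF B]
  note E = is_onb_trace_basis[OF trace_class_onb[OF Y]]
  have bS: "bounded_clinear (S x)" if "x \<in> \<Omega>" for x by (rule positive_op_bounded[OF S(1)[OF that]])
  obtain G H where G: "hilbert_schmidt G" and H: "hilbert_schmidt H" and GH: "Y = G \<circ> H"
    by (rule trace_class_factor[OF Y])
  obtain G' where G': "is_adjoint G G'" using hilbert_schmidt_adjoint_exists[OF G] by blast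
  obtain H' where H': "is_adjoint H H'" using hilbert_schmidt_adjoint_exists[OF H] by blast
  note HG' = hilbert_schmidt_adjoint[OF G G'] and HH' = hilbert_schmidt_adjoint[OF H H']
  let ?\<Phi> = "total_channel \<Omega> (\<lambda>x Y. S x \<circ> Y \<circ> S x) Y"
  let ?t = "\<lambda>x. trace_op (B \<circ> (S x \<circ> Y \<circ> S x))"
  have \<Phi>: "((\<lambda>x. S x (Y (S x v))) has_sum ?\<Phi> v) \<Omega>" for v
    using luders_summable[OF trace_class_bounded[OF Y]] by (simp add: total_channel_def)
  have 1: "trace_op (B \<circ> ?\<Phi>) = infsum ?t \<Omega>"
  proof -
    let ?f = "\<lambda>x e. e \<bullet>\<^sub>C B (S x (Y (S x e)))"
    have "(\<lambda>(x, e). (norm ((G' \<circ> B) (S x e)))\<^sup>2) summable_on \<Omega> \<times> trace_basis"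
      by (rule luders_summable_row[OF hilbert_schmidt_comp_right[OF bB HG'] E])
    moreover have "(\<lambda>(x, e). (norm (H (S x e)))\<^sup>2) summable_on \<Omega> \<times> trace_basis"
      by (rule luders_summable_row[OF H E])
    ultimately have "(\<lambda>(x, e). ((norm ((G' \<circ> B) (S x e)))\<^sup>2 + (norm (H (S x e)))\<^sup>2) / 2)
        summable_on \<Omega> \<times> trace_basis"
      unfolding case_prod_unfold by (rule summable_on_half_add)
    then have f: "(\<lambda>(x, e). ?f x e) summable_on \<Omega> \<times> trace_basis"
    proof (rule summable_on_Times_dominated)
      fix x e assume x: "x \<in> \<Omega>"
      have "?f x e = S x (B e) \<bullet>\<^sub>C Y (S x e)"
        by (simp add: positive_op_symmetric[OF B, symmetric] positive_op_symmetric[OF S(1)[OF x], symmetric])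
      also have "\<dots> = (G' \<circ> B) (S x e) \<bullet>\<^sub>C H (S x e)"
        by (simp add: comm[OF x] GH is_adjointD[OF is_adjoint_sym[OF G']])
      finally show "cmod (?f x e) \<le> ((norm ((G' \<circ> B) (S x e)))\<^sup>2 + (norm (H (S x e)))\<^sup>2) / 2"
        using norm_cinner_le_half_squares by metis
    qed
    have row: "(?f x has_sum ?t x) trace_basis" if "x \<in> \<Omega>" for x
      using trace_op_has_sum[OF trace_class_comp_left[OF bB
          trace_class_comp_right[OF bS[OF that] trace_class_comp_left[OF bS[OF that] Y]]]] by simp
    have col: "((\<lambda>x. ?f x e) has_sum e \<bullet>\<^sub>C B (?\<Phi> e)) \<Omega>" for e
      by (intro cinner_has_sum_right has_sum_bounded_linear[OF bounded_clinear_linear[OF bB]] \<Phi>)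
    show ?thesis
      using has_sum_exchange(3)[OF f row col] by (simp add: trace_op_alt[of "B \<circ> ?\<Phi>"])
  qed
  have 2: "infsum ?t \<Omega> = trace_op (H \<circ> (B \<circ> G))"
  proof -
    \<comment> \<open>The entries of (H S_x)(B S_x G). Commuting B past S_x and moving H and the
      first S_x to the left gives an inner product of two square summable columns.\<close>
    let ?k = "\<lambda>x e. S x (H' e) \<bullet>\<^sub>C S x (B (G e))"
    have "(\<lambda>(x, e). (norm (S x (H' e)))\<^sup>2) summable_on \<Omega> \<times> trace_basis"
      by (rule luders_summable_column[OF HH' E])
    moreover have "(\<lambda>(x, e). (norm (S x ((B \<circ> G) e)))\<^sup>2) summable_on \<Omega> \<times> trace_basis"
      by (rule luders_summable_column[OF hilbert_schmidt_comp_left[OF bB G] E])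
    ultimately have "(\<lambda>(x, e). ((norm (S x (H' e)))\<^sup>2 + (norm (S x ((B \<circ> G) e)))\<^sup>2) / 2)
        summable_on \<Omega> \<times> trace_basis"
      unfolding case_prod_unfold by (rule summable_on_half_add)
    then have k: "(\<lambda>(x, e). ?k x e) summable_on \<Omega> \<times> trace_basis"
      by (rule summable_on_Times_dominated) (unfold o_apply, rule norm_cinner_le_half_squares)
    have row: "(?k x has_sum ?t x) trace_basis" if x: "x \<in> \<Omega>" for x
    proof -
      have L: "hilbert_schmidt (B \<circ> S x \<circ> G)" "hilbert_schmidt (H \<circ> S x)"
        using bounded_clinear_comp[OF bB bS[OF x]] G H bS[OF x]
        by (auto intro: hilbert_schmidt_comp_left hilbert_schmidt_comp_right)
      have "?t x = trace_op ((H \<circ> S x) \<circ> (B \<circ> S x \<circ> G))"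
        using trace_op_hilbert_schmidt_commute[OF L] by (simp add: GH comp_assoc)
      moreover have "?k x e = e \<bullet>\<^sub>C ((H \<circ> S x) \<circ> (B \<circ> S x \<circ> G)) e" for e
        by (simp add: comm[OF x, symmetric] positive_op_symmetric[OF S(1)[OF x]] is_adjointD[OF is_adjoint_sym[OF H']])
      ultimately show ?thesis using trace_op_has_sum[OF hilbert_schmidt_trace_class[OF L(2,1)]] by simp
    qed
    have col: "((\<lambda>x. ?k x e) has_sum e \<bullet>\<^sub>C (H \<circ> (B \<circ> G)) e) \<Omega>" for e
    proof -
      have "((\<lambda>x. H' e \<bullet>\<^sub>C A x (B (G e))) has_sum H' e \<bullet>\<^sub>C B (G e)) \<Omega>"
        by (rule observable_has_sum_cinner[OF A])
      moreover have "?k x e = H' e \<bullet>\<^sub>C A x (B (G e))" if "x \<in> \<Omega>" for x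
        using S(2)[OF that, symmetric] by (simp add: positive_op_symmetric[OF S(1)[OF that]])
      ultimately have "((\<lambda>x. ?k x e) has_sum H' e \<bullet>\<^sub>C B (G e)) \<Omega>" by (simp cong: has_sum_cong)
      then show ?thesis by (simp add: is_adjointD[OF is_adjoint_sym[OF H']])
    qed
    show ?thesis
      using has_sum_exchange(3)[OF k row col] by (simp add: trace_op_alt[of "H \<circ> (B \<circ> G)"])
  qed
  have "trace_op (H \<circ> (B \<circ> G)) = trace_op (B \<circ> Y)"
    using trace_op_hilbert_schmidt_commute[OF H hilbert_schmidt_comp_left[OF bB G]] by (simp add: GH comp_assoc)
  with 1 2 show ?thesis by simp
qed

lemma luders_implements: "implements \<Omega> (\<lambda>x Y. S x \<circ> Y \<circ> S x) A"
  unfolding implements_def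
proof (intro ballI conjI)
  fix x assume x: "x \<in> \<Omega>"
  note pS = S(1)[OF x]
  note bS = positive_op_bounded[OF pS]
  show "trace_class_linear (\<lambda>Y. S x \<circ> Y \<circ> S x)"
    unfolding trace_class_linear_def
  proof (intro conjI allI impI)
    fix T :: "'a \<Rightarrow> 'a" assume "trace_class T"
    then show "trace_class (S x \<circ> T \<circ> S x)"
      by (intro trace_class_comp_right trace_class_comp_left bS)
  qed (simp_all add: fun_eq_iff bounded_clinear_add[OF bS] bounded_clinear_scaleC[OF bS])
  show "completely_positive (\<lambda>Y. S x \<circ> Y \<circ> S x)"
    unfolding completely_positive_def
  proof (intro allI impI)
    fix n :: nat and T :: "nat \<Rightarrow> nat \<Rightarrow> 'a \<Rightarrow> 'a"
    assume "positive_block n T"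
    then have "(\<Sum>i<n. \<Sum>j<n. S x (\<psi> i) \<bullet>\<^sub>C T i j (S x (\<psi> j))) \<in> \<real>\<^sub>\<ge>\<^sub>0" for \<psi>
      unfolding positive_block_def by (rule spec)
    then show "positive_block n (\<lambda>i j. S x \<circ> T i j \<circ> S x)"
      by (simp add: positive_block_def positive_op_symmetric[OF pS])
  qed
  show "dual_value (\<lambda>Y. S x \<circ> Y \<circ> S x) id (A x)"
    unfolding dual_value_def
  proof (intro conjI allI impI bounded_clinear_id)
    show "bounded_clinear (A x)" by (rule positive_op_bounded[OF observable_positive[OF A x]])
    fix Y :: "'a \<Rightarrow> 'a" assume Y: "trace_class Y"
    show "trace_op (id \<circ> (S x \<circ> Y \<circ> S x)) = trace_op (A x \<circ> Y)"
      using trace_op_commute[OF bS trace_class_comp_left[OF bS Y]]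
      by (simp add: S(2)[OF x, symmetric] comp_assoc)
  qed
qed

end

lemma commute_imp_nondisturbing:
  fixes A :: "'i \<Rightarrow> 'a::complex_hilbert \<Rightarrow> 'a"
  assumes B: "observable \<Omega>\<^sub>B B" and A: "observable \<Omega>\<^sub>A A"
    and comm: "observables_commute \<Omega>\<^sub>A A \<Omega>\<^sub>B B"
  shows "measurable_without_disturbing \<Omega>\<^sub>A A \<Omega>\<^sub>B B"
proof -
  have "\<exists>S. positive_op S \<and> S \<circ> S = A x \<and>
    (\<forall>Z. bounded_clinear Z \<longrightarrow> Z \<circ> A x = A x \<circ> Z \<longrightarrow> Z \<circ> S = S \<circ> Z)" if "x \<in> \<Omega>\<^sub>A" for x
    by (rule positive_sqrt_exists[OF observable_positive[OF A that]])
  then obtain S where S: "\<And>x. x \<in> \<Omega>\<^sub>A \<Longrightarrow> positive_op (S x)" "\<And>x. x \<in> \<Omega>\<^sub>A \<Longrightarrow> S x \<circ> S x = A x"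
    "\<And>x Z. x \<in> \<Omega>\<^sub>A \<Longrightarrow> bounded_clinear Z \<Longrightarrow> Z \<circ> A x = A x \<circ> Z \<Longrightarrow> Z \<circ> S x = S x \<circ> Z"
    by metis
  have "dual_value (total_channel \<Omega>\<^sub>A (\<lambda>x Y. S x \<circ> Y \<circ> S x)) (B y) (B y)" if y: "y \<in> \<Omega>\<^sub>B" for y
  proof -
    note By = observable_positive[OF B y]
    have "B y (S x v) = S x (B y v)" if x: "x \<in> \<Omega>\<^sub>A" for x v
    proof -
      have "B y \<circ> A x = A x \<circ> B y" using comm x y by (simp add: observables_commute_def)
      from fun_cong[OF S(3)[OF x positive_op_bounded[OF By] this], of v] show ?thesis by simp
    qed
    from luders_trace[OF A S(1,2) By this] show ?thesis
      using positive_op_bounded[OF By] by (simp add: dual_value_def)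
  qed
  with luders_implements[OF A S(1,2)] show ?thesis
    unfolding measurable_without_disturbing_def by blast
qed

theorem proposition3:
  fixes A :: "'i \<Rightarrow> 'a::complex_hilbert \<Rightarrow> 'a" and \<Omega>\<^sub>A :: "'i set"
    and B :: "'j \<Rightarrow> 'a \<Rightarrow> 'a" and \<Omega>\<^sub>B :: "'j set"
  assumes countable_dimension: "\<exists>E :: 'a set. is_onb E \<and> countable E"
    and B: "observable \<Omega>\<^sub>B B"
    and B_square: "\<And>y. y \<in> \<Omega>\<^sub>B \<Longrightarrow> B y \<circ> B y \<in> sigma_weak_topology closure_of op_span \<Omega>\<^sub>B B"
    and A: "observable \<Omega>\<^sub>A A"
  shows "measurable_without_disturbing \<Omega>\<^sub>A A \<Omega>\<^sub>B B \<longleftrightarrow> observables_commute \<Omega>\<^sub>A A \<Omega>\<^sub>B B"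
proof
  have onb: "\<exists>E :: 'a set. is_onb E" using countable_dimension by blast
  assume "measurable_without_disturbing \<Omega>\<^sub>A A \<Omega>\<^sub>B B"
  then obtain I where I: "implements \<Omega>\<^sub>A I A"
    "\<And>y. y \<in> \<Omega>\<^sub>B \<Longrightarrow> dual_value (total_channel \<Omega>\<^sub>A I) (B y) (B y)"
    unfolding measurable_without_disturbing_def by blast
  show "observables_commute \<Omega>\<^sub>A A \<Omega>\<^sub>B B"
    using nondisturbing_imp_commute[OF onb B B_square A I]
    by (simp add: observables_commute_def fun_eq_iff)
next
  assume "observables_commute \<Omega>\<^sub>A A \<Omega>\<^sub>B B"
  then show "measurable_without_disturbing \<Omega>\<^sub>A A \<Omega>\<^sub>B B"
    by (rule commute_imp_nondisturbing[OF B A])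
qed

end
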